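(* For every irrational $P\in(0,1)$ the polyhedron exchange transformation $F_P$ of $X_P$ has an infinite orbit whose corresponding plaid path has infinite diameter projections in both coordinate directions. That is, there is a point $x\in X_P$ such that $F_P^n(x)$ is defined for all $n\in\mathbb{Z}$, the set $\{F_P^n(x): n\in\mathbb{Z}\}$ is infinite, and the plaid path $\{c_n\}_{n\in\mathbb{Z}}\subset\mathbb{R}^2$ of $x$ has unbounded projection to the $x$-axis and unbounded projection to the $y$-axis.
   Context: Fix $P\in(0,1)$. Let $\Lambda_P\subset\mathbb{R}^3$ (coordinates $(T,U_1,U_2)$) be the lattice generated by $(4,2P,2P)$, $(0,2,0)$, $(0,0,2)$, and let $X_P=\mathbb{R}^3/\Lambda_P$ (the paper writes $X_P=(\{P\}\times\mathbb{R}^3)/\Lambda_P$, and $\widehat X_P$ in its introduction). The partition of $X_P$: it has $13$ labels, namely the 12 ordered pairs $(\text{in},\text{out})$ of distinct letters in $\{N,S,E,W\}$, and an empty symbol. For $t\in[-1,1]$ define cut points $c_1\le c_2\le c_3$ in $[-1,1]$ and a word of four letters: - if $-1\le t\le P-1$: $(c_1,c_2,c_3)=(t,\,1-P,\,t+2-P)$, word $N,E,S,W$; - if $P-1\le t\le 1-P$: $(c_1,c_2,c_3)=(P-1,\,t,\,1-P)$, word $N,W,E,S$; - if $1-P\le t\le 1$: $(c_1,c_2,c_3)=(t+P-2,\,P-1,\,t)$, word $E,N,W,S$. For $u\in\mathbb{R}/2\mathbb{Z}$, represented in $[-1,1]$ and not equal to $-1,1$ or a cut point, the column letter $\mathrm{col}_t(u)$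 is the letter of the word in position $1,2,3,4$ according to which of the intervals $(-1,c_1),(c_1,c_2),(c_2,c_3),(c_3,1)$ contains $u$. The row letter $\mathrm{row}_t(u)$ is obtained from $\mathrm{col}_t(u)$ by interchanging $N$ and $S$ (and fixing $E,W$). Every point of $X_P$ has a representative $(T,U_1,U_2)$ with $T\in[-1,3]$. - If $T\in[-1,1]$, put $t=T$, $u_i=U_i$ and $(\text{in},\text{out})=(\mathrm{col}_t(u_1),\mathrm{row}_t(u_2))$. - If $T\in[1,3]$, put $t=T-2$, $u_i=U_i-P$ and $(\text{in},\text{out})=(\mathrm{row}_t(u_2),\mathrm{col}_t(u_1))$. If the two letters coincide, the label is the empty symbol. For each label $\xi$, the piece $X_P(\xi)$ is the closure of the set of points so labelled with $t$ in one of the open intervals $(-1,P-1),(P-1,1-P),(1-P,1)$. The walls of the partition are the points not in the interior of any piece. The transformation $F_P$ is defined at points in interiors of pieces. It is the identity on the empty piece. On pieces with out-letter $N$, $S$, $E$, $W$ it is the translation of $X_P$ by, respectively, $(2,0,2P)$, $(-2,0,-2P)$, $(2P,2P,2P)$, $(-2P,-2P,-2P)$. It carries pieces with out-letter $S$ to pieces with in-letter $N$, and so on, and it is invertible off the walls. (The second partition of the exchange is obtained by grouping by in-letters.) "$F_P^n(x)$ is defined for all $n\in\mathbb{Z}$" means that all forward and backward iterates exist and stay in interiors of pieces. Vector dynamics and plaid path: to a point of out-letter $N,S,E,W$ assign the vector $v=(0,1),(0,-1),(1,0),(-1,0)$ respectively, and $v=(0,0)$ on the empty piece. The plaid path of $x$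 is the sequence $\{c_n\}_{n\in\mathbb{Z}}$ in $\mathbb{R}^2$, determined up to translation, with $c_{n+1}-c_n=v(F_P^n(x))$ (or the polygonal path through these points). *)

theory Defs
  imports "HOL-Analysis.Analysis"
begin

section \<open>The quotient space\<close>

text \<open>Coordinates of \<^typ>\<open>real \<times> real \<times> real\<close> are \<open>(T, U1, U2)\<close>.\<close>

definition lattice :: "real \<Rightarrow> (real \<times> real \<times> real) set" where
  "lattice P = {of_int a *\<^sub>R (4, 2 * P, 2 * P) + of_int b *\<^sub>R (0, 2, 0) + of_int c *\<^sub>R (0, 0, 2)
                | a b c :: int. True}"

type_synonym point = "(real \<times> real \<times> real) set"

definition lattice_rel :: "real \<Rightarrow> ((real \<times> real \<times> real) \<times> (real \<times> real \<times> real)) set" where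
  "lattice_rel P = {(p, q). q - p \<in> lattice P}"

definition XP :: "real \<Rightarrow> point set" where
  "XP P = UNIV // lattice_rel P"

definition proj :: "real \<Rightarrow> real \<times> real \<times> real \<Rightarrow> point" where
  "proj P p = lattice_rel P `` {p}"

definition XP_top :: "real \<Rightarrow> point topology" where
  "XP_top P = topology (\<lambda>U. U \<subseteq> XP P \<and> open (proj P -` U))"

lemma openin_XP_top: "openin (XP_top P) U \<longleftrightarrow> U \<subseteq> XP P \<and> open (proj P -` U)"
proof -
  have "istopology (\<lambda>U. U \<subseteq> XP P \<and> open (proj P -` U))"
    unfolding istopology_def
    by (auto simp: vimage_Int vimage_Union intro!: open_Int open_UN)
  then show ?thesis
    unfolding XP_top_def by simp
qed

lemma range_proj: "range (proj P) = XP P"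
  by (auto simp: XP_def proj_def quotient_def)

lemma topspace_XP_top [simp]: "topspace (XP_top P) = XP P"
proof -
  have "proj P -` XP P = UNIV"
    using range_proj by blast
  then have "openin (XP_top P) (XP P)"
    by (simp add: openin_XP_top)
  then show ?thesis
    by (metis openin_XP_top openin_subset openin_topspace subset_antisym)
qed

lemma quotient_map_proj: "quotient_map euclidean (XP_top P) (proj P)"
  by (simp add: quotient_map_def range_proj openin_XP_top vimage_def)

text \<open>Translations of \<open>\<real>\<^sup>3\<close> map cosets of the lattice to cosets, so they act on the quotient.\<close>

definition translate :: "real \<times> real \<times> real \<Rightarrow> point \<Rightarrow> point" where
  "translate w x = (+) w ` x"

lemma translate_proj: "translate w (proj P p) = proj P (w + p)"
proof -
  have "q \<in> (+) w ` {q. q - p \<in> lattice P}" if "q - (w + p) \<in> lattice P" for q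
    using that by (intro image_eqI[where x = "q - w"]) (auto simp: algebra_simps)
  then show ?thesis
    by (auto simp: translate_def proj_def lattice_rel_def algebra_simps)
qed

section \<open>The partition\<close>

datatype letter = North | South | East | West

text \<open>\<open>Pass a b\<close> stands for the ordered pair \<open>(in, out) = (a, b)\<close>.\<close>

datatype label = Empty | Pass letter letter

definition labels :: "label set" where
  "labels = insert Empty {Pass a b | a b. a \<noteq> b}"

fun flip_NS :: "letter \<Rightarrow> letter" where
  "flip_NS North = South"
| "flip_NS South = North"
| "flip_NS East = East"
| "flip_NS West = West"

definition cuts :: "real \<Rightarrow> real \<Rightarrow> real \<times> real \<times> real" where
  "cuts P t =
     (if t \<le> P - 1 then (t, 1 - P, t + 2 - P)
      else if t \<le> 1 - P then (P - 1, t, 1 - P)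
      else (t + P - 2, P - 1, t))"

definition word :: "real \<Rightarrow> real \<Rightarrow> letter \<times> letter \<times> letter \<times> letter" where
  "word P t =
     (if t \<le> P - 1 then (North, East, South, West)
      else if t \<le> 1 - P then (North, West, East, South)
      else (East, North, West, South))"

text \<open>The representative in \<open>[-1, 1)\<close> of the class of \<open>u\<close> in \<open>\<real>/2\<int>\<close>.\<close>

definition rep2 :: "real \<Rightarrow> real" where
  "rep2 u = u - 2 * of_int \<lfloor>(u + 1) / 2\<rfloor>"

text \<open>The value \<^const>\<open>None\<close> means that \<open>u\<close> is, modulo 2, a cut point or \<open>-1\<close>.\<close>

definition col :: "real \<Rightarrow> real \<Rightarrow> real \<Rightarrow> letter option" where
  "col P t u =
     (let (c1, c2, c3) = cuts P t; (l1, l2, l3, l4) = word P t; r = rep2 u in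
      if -1 < r \<and> r < c1 then Some l1
      else if c1 < r \<and> r < c2 then Some l2
      else if c2 < r \<and> r < c3 then Some l3
      else if c3 < r \<and> r < 1 then Some l4
      else None)"

definition row :: "real \<Rightarrow> real \<Rightarrow> real \<Rightarrow> letter option" where
  "row P t u = map_option flip_NS (col P t u)"

definition mk_label :: "letter \<Rightarrow> letter \<Rightarrow> label" where
  "mk_label a b = (if a = b then Empty else Pass a b)"

definition open_times :: "real \<Rightarrow> real set" where
  "open_times P = {-1 <..< P - 1} \<union> {P - 1 <..< 1 - P} \<union> {1 - P <..< 1}"

definition labelled :: "real \<Rightarrow> label \<Rightarrow> point set" where
  "labelled P \<xi> =
     {proj P (T, U1, U2) | T U1 U2. \<exists>a b. \<xi> = mk_label a b \<and>
        (T \<in> open_times P \<and>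
           col P T U1 = Some a \<and> row P T U2 = Some b
         \<or> T - 2 \<in> open_times P \<and>
           row P (T - 2) (U2 - P) = Some a \<and> col P (T - 2) (U1 - P) = Some b)}"

definition piece :: "real \<Rightarrow> label \<Rightarrow> point set" where
  "piece P \<xi> = (XP_top P) closure_of (labelled P \<xi>)"

abbreviation piece_interior :: "real \<Rightarrow> label \<Rightarrow> point set" where
  "piece_interior P \<xi> \<equiv> (XP_top P) interior_of (piece P \<xi>)"

definition walls :: "real \<Rightarrow> point set" where
  "walls P = XP P - (\<Union>\<xi>\<in>labels. piece_interior P \<xi>)"

text \<open>The pieces are closures of pairwise disjoint open sets, so their interiors are pairwise
  disjoint and a point off the walls has exactly one label.\<close>

definition label_of :: "real \<Rightarrow> point \<Rightarrow> label" where
  "label_of P x = (THE \<xi>. \<xi> \<in> labels \<and> x \<in> piece_interior P \<xi>)"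

section \<open>The exchange transformation and its vector dynamics\<close>

fun shift :: "real \<Rightarrow> label \<Rightarrow> real \<times> real \<times> real" where
  "shift P Empty = (0, 0, 0)"
| "shift P (Pass a North) = (2, 0, 2 * P)"
| "shift P (Pass a South) = (-2, 0, -2 * P)"
| "shift P (Pass a East) = (2 * P, 2 * P, 2 * P)"
| "shift P (Pass a West) = (-2 * P, -2 * P, -2 * P)"

definition F :: "real \<Rightarrow> point \<Rightarrow> point option" where
  "F P x = (if x \<in> XP P - walls P then Some (translate (shift P (label_of P x)) x) else None)"

text \<open>A sequence \<open>z\<close> with \<open>z n = F\<^sup>n(x)\<close> for all integers \<open>n\<close>. Each \<open>z n\<close> lies off the walls,
  and for negative \<open>n\<close> the point \<open>z n\<close> is the preimage of \<open>z (n + 1)\<close> (unique, since the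
  transformation is injective off the walls).\<close>

definition full_orbit :: "real \<Rightarrow> point \<Rightarrow> (int \<Rightarrow> point) \<Rightarrow> bool" where
  "full_orbit P x z \<longleftrightarrow> z 0 = x \<and> (\<forall>n. F P (z n) = Some (z (n + 1)))"

fun step_vector :: "label \<Rightarrow> real \<times> real" where
  "step_vector Empty = (0, 0)"
| "step_vector (Pass a North) = (0, 1)"
| "step_vector (Pass a South) = (0, -1)"
| "step_vector (Pass a East) = (1, 0)"
| "step_vector (Pass a West) = (-1, 0)"

definition plaid_path :: "real \<Rightarrow> (int \<Rightarrow> point) \<Rightarrow> (int \<Rightarrow> real \<times> real) \<Rightarrow> bool" where
  "plaid_path P z c \<longleftrightarrow> (\<forall>n. c (n + 1) - c n = step_vector (label_of P (z n)))"

end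

theory Submission
  imports Defs
begin

text \<open>
  Take the orbit of the class of \<open>(1, P/2, P/2 + 1)\<close>. Its labels, read along the translations by
  \<open>(2P, 2P, 2P)\<close> and \<open>(2, 0, 2P)\<close>, give a tiling of the square grid in which the plaid path
  lives. The map \<open>p \<mapsto> (2, P, P) - p\<close> fixes the starting point and exchanges \<open>(in, out)\<close> with the
  opposites of \<open>(out, in)\<close>, so the path satisfies \<open>c(-n) = -c(n)\<close>. A closed path has even period
  \<open>2m\<close>, and then \<open>c(m) = c(-m) = -c(m)\<close> gives \<open>c(m) = 0\<close>, a shorter period; hence the path visits
  infinitely many squares.

  For every \<open>M\<close> there is a horizontal grid line that no path crosses within distance \<open>M\<close> of the
  vertical axis, and a vertical grid line with the analogous property. By symmetry such lines occur
  in opposite pairs, so a path confined to a vertical or horizontal strip would be confined to a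
  bounded rectangle, which is impossible. These lines are those where the intervals of
  the partition that produce crossings nearly cancel or nearly vanish; they are found by
  approximating multiples of \<open>P\<close> by integers.
\<close>

section \<open>Centrally symmetric tilings\<close>

fun opp :: "letter \<Rightarrow> letter" where
  "opp North = South"
| "opp South = North"
| "opp East = West"
| "opp West = East"

lemma opp_opp [simp]: "opp (opp l) = l"
  by (cases l) auto

lemma opp_eq_iff [simp]: "opp a = opp b \<longleftrightarrow> a = b"
  by (metis opp_opp)

fun dir :: "letter \<Rightarrow> int \<times> int" where
  "dir North = (0, 1)"
| "dir South = (0, -1)"
| "dir East = (1, 0)"
| "dir West = (-1, 0)"

lemma dir_opp [simp]: "dir (opp l) = - dir l"
  by (cases l) (auto simp: uminus_prod_def)

text \<open>A tile is entered through its side \<open>inn a\<close> and left through its side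
  \<open>out a\<close>; equal letters encode an empty tile. A gluing condition on exits suffices,
  since backward continuation is supplied by \<open>sym\<close>.\<close>

locale symmetric_tiling =
  fixes inn out :: "int \<times> int \<Rightarrow> letter"
  assumes match: "inn a \<noteq> out a \<Longrightarrow>
      inn (a + dir (out a)) = opp (out a) \<and> out (a + dir (out a)) \<noteq> opp (out a)"
    and sym: "inn a \<noteq> out a \<Longrightarrow> inn (- a) = opp (out a) \<and> out (- a) = opp (inn a)"
    and start: "inn 0 \<noteq> out 0"
begin

definition active :: "int \<times> int \<Rightarrow> bool" where
  "active a \<longleftrightarrow> inn a \<noteq> out a"

definition step :: "int \<times> int \<Rightarrow> int \<times> int" where
  "step a = a + dir (out a)"

text \<open>The backward half is taken to be the central image of the forward half, which makes
  \<open>path_minus\<close> immediate; that the two halves join into one orbit of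
  \<open>step\<close> is the content of \<open>path_Suc\<close>.\<close>

definition path :: "int \<Rightarrow> int \<times> int" where
  "path n = (if 0 \<le> n then (step ^^ nat n) 0 else - (step ^^ nat (- n)) 0)"

lemma path_0 [simp]: "path 0 = 0"
  by (simp add: path_def)

lemma path_minus: "path (- n) = - path n"
  by (auto simp: path_def)

lemma active_step: "active a \<Longrightarrow> active (step a)"
  using match[of a] by (auto simp: active_def step_def)

lemma active_minus: "active a \<Longrightarrow> active (- a)"
  using sym[of a] by (auto simp: active_def)

lemma inn_step: "active a \<Longrightarrow> inn (step a) = opp (out a)"
  using match[of a] by (auto simp: active_def step_def)

lemma step_inj: "active a \<Longrightarrow> active b \<Longrightarrow> step a = step b \<Longrightarrow> a = b"
  using inn_step[of a] inn_step[of b] by (auto simp: step_def)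

text \<open>Central reflection reverses the orientation of paths: the exit of the reflected tile is
  opposite to the entrance of the original one, and that entrance is
  \<open>opp (out a)\<close>.\<close>

lemma step_minus_step: "active a \<Longrightarrow> step (- step a) = - a"
  using sym[of "step a"] active_step[of a] inn_step[of a] by (auto simp: step_def active_def)

lemma active_path: "active (path n)"
proof -
  have "active ((step ^^ k) 0)" for k
    by (induction k) (auto simp: active_step start[folded active_def])
  then show ?thesis
    by (auto simp: path_def active_minus)
qed

lemma path_Suc: "path (n + 1) = step (path n)"
proof (cases "0 \<le> n")
  case True
  then show ?thesis
    by (simp add: path_def nat_add_distrib)
next
  case False
  define m where "m = - n - 1"
  have m: "0 \<le> m" "n = - (m + 1)" "n + 1 = - m"
    using False by (auto simp: m_def)
  have "path (m + 1) = step (path m)"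
    using m by (simp add: path_def nat_add_distrib)
  then have "step (- path (m + 1)) = - path m"
    using step_minus_step[OF active_path[of m]] by simp
  then show ?thesis
    by (metis m(2,3) path_minus)
qed

text \<open>A coincidence propagates backwards as well, because \<open>step\<close> is injective on
  active tiles: the entrance of a tile determines its predecessor.\<close>

lemma path_eq_shift: "path i = path j \<Longrightarrow> path (i + k) = path (j + k)"
proof (induction k rule: int_induct[where k = 0])
  case (step1 k)
  then show ?case
    by (metis add.assoc path_Suc)
next
  case (step2 k)
  have "step (path (i + (k - 1))) = step (path (j + (k - 1)))"
    using step2 by (simp flip: path_Suc)
  then show ?case
    by (rule step_inj[OF active_path active_path])
qed simp

text \<open>Each step changes the colour of the square in the checkerboard colouring.\<close>

lemma even_path: "even (fst (path n) + snd (path n)) \<longleftrightarrow> even n"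
proof -
  have *: "even (fst (step a) + snd (step a)) \<longleftrightarrow> odd (fst a + snd a)" for a
    by (cases "out a") (auto simp: step_def)
  show ?thesis
    by (induction n rule: int_induct[where k = 0])
       (simp, metis * path_Suc even_plus_one_iff, metis * path_Suc even_plus_one_iff diff_add_cancel)
qed

lemma path_not_0: "0 < n \<Longrightarrow> path (int n) \<noteq> 0"
proof (induction n rule: less_induct)
  case (less n)
  show ?case
  proof
    assume 0: "path (int n) = 0"
    then have "even (int n)"
      using even_path[of "int n"] by simp
    then obtain m where m: "n = 2 * m"
      by auto
    have "path (int m) = path (- int m)"
      using path_eq_shift[of "int n" 0 "- int m"] 0 by (simp add: m)
    then have "path (int m) = 0"
      by (simp add: path_minus prod_eq_iff)
    then show False
      using less m by auto
  qed
qed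

lemma inj_path: "inj path"
proof -
  have *: False if "path i = path j" "i < j" for i j
    using path_eq_shift[OF that(1), of "- i"] path_not_0[of "nat (j - i)"] that(2) by simp
  show ?thesis
    by (rule injI) (metis * linorder_neqE)
qed

section \<open>Confinement of paths by uncrossed grid lines\<close>

lemma path_not_in_box: "\<exists>n. \<not> (\<bar>fst (path n)\<bar> \<le> M \<and> \<bar>snd (path n)\<bar> \<le> K)"
proof (rule ccontr)
  assume "\<not> ?thesis"
  then have "\<bar>fst (path n)\<bar> \<le> M \<and> \<bar>snd (path n)\<bar> \<le> K" for n
    by simp
  then have "path n \<in> {-M..M} \<times> {-K..K}" for n
    by (simp add: mem_Times_iff abs_le_iff minus_le_iff)
  then have "range path \<subseteq> {-M..M} \<times> {-K..K}"
    by blast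
  then have "finite (range path)"
    by (rule finite_subset) auto
  then show False
    using finite_imageD[OF _ inj_path] by simp
qed

text \<open>The height \<open>f\<close> rises by at most one per step, and only through a side
  \<open>d\<close>, so passing level \<open>l\<close> would require such a side on a tile of height
  exactly \<open>l\<close>. Forward steps leave through \<open>out\<close>; backward steps leave
  through \<open>inn\<close>, which is why both are required to differ from
  \<open>d\<close>.\<close>

lemma path_stays_below:
  fixes f :: "int \<times> int \<Rightarrow> int"
  assumes f: "\<And>a b. f (a + b) = f a + f b" "f 0 = 0" "f (dir d) = 1" "\<And>e. e \<noteq> d \<Longrightarrow> f (dir e) \<le> 0"
    and "0 \<le> l"
    and blocked: "\<And>n. f (path n) = l \<Longrightarrow> inn (path n) \<noteq> d \<and> out (path n) \<noteq> d"
  shows "f (path n) \<le> l"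
proof (induction n rule: int_induct[where k = 0])
  case base
  then show ?case
    using f \<open>0 \<le> l\<close> by simp
next
  case (step1 n)
  have "path (n + 1) = path n + dir (out (path n))"
    by (simp only: path_Suc step_def)
  then have "f (path (n + 1)) = f (path n) + f (dir (out (path n)))"
    by (simp add: f(1))
  then show ?case
    using step1(2) f(3) f(4)[of "out (path n)"] blocked[of n]
    by (cases "out (path n) = d"; cases "f (path n) = l") auto
next
  case (step2 n)
  have "path n = path (n - 1) - dir (inn (path n))"
    using path_Suc[of "n - 1"] inn_step[OF active_path[of "n - 1"]]
    by (simp add: step_def[of "path (n - 1)"])
  then have "f (path (n - 1)) = f (path n) + f (dir (inn (path n)))"
    by (metis diff_add_cancel f(1))
  then show ?case
    using step2(2) f(3) f(4)[of "inn (path n)"] blocked[of n]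
    by (cases "inn (path n) = d"; cases "f (path n) = l") auto
qed

lemma unbounded_fst:
  assumes "0 \<le> y"
    and "\<And>x. \<bar>x\<bar> \<le> M \<Longrightarrow> active (x, y) \<Longrightarrow> inn (x, y) \<noteq> North \<and> out (x, y) \<noteq> North"
  shows "\<exists>n. M < \<bar>fst (path n)\<bar>"
proof (rule ccontr)
  assume "\<not> ?thesis"
  then have M: "\<bar>fst (path n)\<bar> \<le> M" for n
    by (simp add: not_less)
  have "inn (path n) \<noteq> North \<and> out (path n) \<noteq> North" if "snd (path n) = y" for n
    using assms(2)[OF M] active_path that by (metis prod.collapse)
  moreover have "snd (dir e) \<le> 0" if "e \<noteq> North" for e
    using that by (cases e) auto
  \<comment> \<open>The bound at \<open>- n\<close> becomes the lower bound \<open>- y\<close> at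
    \<open>n\<close> by central symmetry.\<close>
  ultimately have "snd (path n) \<le> y" "snd (path (- n)) \<le> y" for n
    using path_stays_below[where d = North and f = snd and l = y] assms(1) by simp_all
  then have "\<bar>snd (path n)\<bar> \<le> y" for n
    by (simp add: path_minus abs_le_iff)
  then show False
    using path_not_in_box M by blast
qed

lemma unbounded_snd:
  assumes "0 \<le> x"
    and "\<And>y. \<bar>y\<bar> \<le> M \<Longrightarrow> active (x, y) \<Longrightarrow> inn (x, y) \<noteq> East \<and> out (x, y) \<noteq> East"
  shows "\<exists>n. M < \<bar>snd (path n)\<bar>"
proof (rule ccontr)
  assume "\<not> ?thesis"
  then have M: "\<bar>snd (path n)\<bar> \<le> M" for n
    by (simp add: not_less)
  have "inn (path n) \<noteq> East \<and> out (path n) \<noteq> East" if "fst (path n) = x" for n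
    using assms(2)[OF M] active_path that by (metis prod.collapse)
  moreover have "fst (dir e) \<le> 0" if "e \<noteq> East" for e
    using that by (cases e) auto
  ultimately have "fst (path n) \<le> x" "fst (path (- n)) \<le> x" for n
    using path_stays_below[where d = East and f = fst and l = x] assms(1) by simp_all
  then have "\<bar>fst (path n)\<bar> \<le> x" for n
    by (simp add: path_minus abs_le_iff)
  then show False
    using path_not_in_box M by blast
qed

end

section \<open>Diophantine approximation\<close>

lemma irrational_multiple:
  fixes P :: real
  assumes "P \<notin> \<rat>" "P * of_int a = of_int b"
  shows "a = 0"
proof (rule ccontr)
  assume "a \<noteq> 0"
  then have "P = of_int b / of_int a"
    using assms(2) by (simp add: field_simps)
  then show False
    using assms(1) by simp
qed

lemma finite_away_from_even:
  fixes S :: "real set"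
  assumes "finite S" "\<And>s m. s \<in> S \<Longrightarrow> s \<noteq> 2 * of_int m"
  shows "\<exists>\<epsilon>>0. \<forall>s\<in>S. \<forall>m. \<epsilon> \<le> \<bar>s - 2 * of_int m\<bar>"
  using assms
proof (induction rule: finite_induct)
  case (insert s S)
  then obtain \<epsilon> where \<epsilon>: "\<epsilon> > 0" "\<forall>s\<in>S. \<forall>m. \<epsilon> \<le> \<bar>s - 2 * of_int m\<bar>"
    by auto
  define n where "n = \<lfloor>s / 2\<rfloor>"
  \<comment> \<open>This is the distance from \<open>s\<close> to the nearest even integer.\<close>
  define d where "d = min (s - 2 * of_int n) (2 * of_int n + 2 - s)"
  have "2 * of_int n \<le> s" "s < 2 * of_int n + 2"
    unfolding n_def by linarith+
  moreover have "s \<noteq> 2 * of_int n"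
    using insert.prems by blast
  ultimately have "d > 0"
    by (simp add: d_def)
  moreover have "d \<le> \<bar>s - 2 * of_int m\<bar>" for m
  proof (cases "m \<le> n")
    case True
    then have "real_of_int m \<le> of_int n"
      by simp
    then show ?thesis
      by (simp add: d_def)
  next
    case False
    then have "real_of_int n + 1 \<le> of_int m"
      by linarith
    then show ?thesis
      by (simp add: d_def)
  qed
  ultimately show ?case
    using \<epsilon> by (intro exI[of _ "min d \<epsilon>"]) (auto simp: min.coboundedI1 min.coboundedI2)
qed (auto intro: exI[of _ 1])

text \<open>This is the density of the fractional parts of the multiples of \<open>P\<close>,
  applied to the target \<open>- c / 2\<close> and doubled.\<close>

lemma int_multiple_approx:
  fixes P :: real
  assumes "P \<notin> \<rat>" "\<epsilon> > 0"
  obtains k m :: int where "k \<ge> 0" "\<bar>2 * P * of_int k + c - 2 * of_int m\<bar> < \<epsilon>"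
proof -
  obtain m k where "k > 0" "\<bar>of_int k * P - of_int m - (- c / 2)\<bar> < \<epsilon> / 2"
    by (rule sequence_of_fractional_parts_is_dense[OF assms(1), of "\<epsilon> / 2" "- c / 2"])
      (use assms(2) in simp)
  then show thesis
    by (intro that[of k m]) (auto simp: abs_if field_simps split: if_splits)
qed

text \<open>If \<open>X = 2x + 1\<close> with \<open>P X \<approx> 2N\<close> is bad because of \<open>h\<close>, and the odd multiple \<open>r X\<close> is bad
  because of \<open>h'\<close>, then \<open>P (h' - r h)\<close> is almost an even integer, so \<open>h' = r h\<close>; this is
  impossible once \<open>r > H\<close>.\<close>

lemma good_odd_multiple:
  fixes P \<eta> :: real and H :: int
  assumes P: "P \<notin> \<rat>" and "0 \<le> H" and "\<eta> > 0"
  obtains x N :: int where "x \<ge> 0" "\<bar>P * (2 * of_int x + 1) - 2 * of_int N\<bar> < \<eta>"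
    "\<And>h m :: int. odd h \<Longrightarrow> \<bar>h\<bar> \<le> H \<Longrightarrow>
       2 * \<bar>P * (2 * of_int x + 1) - 2 * of_int N\<bar> \<le> \<bar>P * (2 * of_int N + of_int h) - 2 * of_int m\<bar>"
proof -
  \<comment> \<open>The factor must exceed \<open>H\<close> and be odd: then
    \<open>r * (2 * x + 1) = 2 * (r * x + H) + 1\<close> is again an odd multiple.\<close>
  define r where "r = 2 * H + 1"
  have r: "r > H" "r > 0"
    using \<open>0 \<le> H\<close> by (auto simp: r_def)
  \<comment> \<open>The index range contains every nonzero difference \<open>h' - r * h\<close> with
    \<open>h\<close> and \<open>h'\<close> bounded by \<open>H\<close>.\<close>
  define S where "S = (\<lambda>k. P * of_int k) ` ({- ((r + 1) * H)..(r + 1) * H} - {0})"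
  have "\<exists>\<epsilon>>0. \<forall>s\<in>S. \<forall>m. \<epsilon> \<le> \<bar>s - 2 * of_int m\<bar>"
  proof (rule finite_away_from_even)
    show "s \<noteq> 2 * of_int m" if "s \<in> S" for s m
      using that irrational_multiple[OF P, of _ "2 * m"] by (auto simp: S_def)
  qed (simp add: S_def)
  then obtain \<epsilon> where "\<epsilon> > 0" and \<epsilon>: "\<And>s m. s \<in> S \<Longrightarrow> \<epsilon> \<le> \<bar>s - 2 * of_int m\<bar>"
    by blast
  \<comment> \<open>Division by \<open>r\<close> leaves room for the second candidate, whose error
    is \<open>r\<close> times larger. The fraction \<open>\<epsilon> / 4\<close> is used because two
    errors below \<open>2 * r * \<bar>e\<bar>\<close> are added later.\<close>
  obtain x N where x: "x \<ge> 0"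
    and "\<bar>2 * P * of_int x + P - 2 * of_int N\<bar> < min \<eta> (\<epsilon> / 4) / of_int r"
    using int_multiple_approx[OF P, of "min \<eta> (\<epsilon> / 4) / of_int r" P] \<open>\<eta> > 0\<close> \<open>\<epsilon> > 0\<close> r by auto
  define e where "e = P * (2 * of_int x + 1) - 2 * of_int N"
  have e: "of_int r * \<bar>e\<bar> < \<eta>" "4 * of_int r * \<bar>e\<bar> < \<epsilon>"
    using \<open>\<bar>_\<bar> < min _ _ / _\<close> r by (auto simp: e_def field_simps)
  show thesis
  proof (cases "\<forall>h m :: int. odd h \<longrightarrow> \<bar>h\<bar> \<le> H \<longrightarrow>
       2 * \<bar>e\<bar> \<le> \<bar>P * (2 * of_int N + of_int h) - 2 * of_int m\<bar>")
    case True
    have "1 * \<bar>e\<bar> \<le> of_int r * \<bar>e\<bar>"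
      using r by (intro mult_right_mono) auto
    with True show thesis
      using x e by (intro that[of x N]) (auto simp: e_def)
  next
    case False
    then obtain h m :: int where h: "odd h" "\<bar>h\<bar> \<le> H"
      "\<bar>P * (2 * of_int N + of_int h) - 2 * of_int m\<bar> < 2 * \<bar>e\<bar>"
      by (auto simp: not_le)
    have re: "P * (2 * of_int (r * x + H) + 1) - 2 * of_int (r * N) = of_int r * e"
      by (simp add: e_def r_def algebra_simps)
    show thesis
    proof (rule that[of "r * x + H" "r * N"])
      show "\<bar>P * (2 * of_int (r * x + H) + 1) - 2 * of_int (r * N)\<bar> < \<eta>"
        unfolding re using e r by (simp add: abs_mult)
      fix h' m' :: int
      assume h': "odd h'" "\<bar>h'\<bar> \<le> H"
      show "2 * \<bar>P * (2 * of_int (r * x + H) + 1) - 2 * of_int (r * N)\<bar>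
          \<le> \<bar>P * (2 * of_int (r * N) + of_int h') - 2 * of_int m'\<bar>"
      proof (rule ccontr)
        assume "\<not> ?thesis"
        then have 1: "\<bar>P * (2 * of_int (r * N) + of_int h') - 2 * of_int m'\<bar> < 2 * (of_int r * \<bar>e\<bar>)"
          unfolding re using r by (simp add: abs_mult)
        have "of_int r * \<bar>P * (2 * of_int N + of_int h) - 2 * of_int m\<bar> < of_int r * (2 * \<bar>e\<bar>)"
          using h(3) r by (intro mult_strict_left_mono) auto
        then have 2: "\<bar>of_int r * (P * (2 * of_int N + of_int h) - 2 * of_int m)\<bar> < 2 * (of_int r * \<bar>e\<bar>)"
          using r by (simp add: abs_mult)
        have "P * of_int (h' - r * h) - 2 * of_int (m' - r * m)
           = (P * (2 * of_int (r * N) + of_int h') - 2 * of_int m')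
             - of_int r * (P * (2 * of_int N + of_int h) - 2 * of_int m)"
          by (simp add: algebra_simps)
        with 1 2 e have "\<bar>P * of_int (h' - r * h) - 2 * of_int (m' - r * m)\<bar> < \<epsilon>"
          by linarith
        then have "P * of_int (h' - r * h) \<notin> S"
          using \<epsilon> not_less by blast
        moreover have "\<bar>r * h\<bar> \<le> r * H"
          using h(2) r by (simp add: abs_mult)
        then have "\<bar>h' - r * h\<bar> \<le> (r + 1) * H"
          using h'(2) by (simp add: algebra_simps)
        then have "h' - r * h \<in> {- ((r + 1) * H)..(r + 1) * H}"
          unfolding atLeastAtMost_iff abs_le_iff by linarith
        ultimately have "h' - r * h = 0"
          unfolding S_def by blast
        then have "h' = r * h"
          by simp
        then have "\<bar>h'\<bar> = r * \<bar>h\<bar>"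
          using r by (simp add: abs_mult)
        moreover have "1 \<le> \<bar>h\<bar>"
          using h(1) by presburger
        then have "r \<le> r * \<bar>h\<bar>"
          using r by simp
        ultimately show False
          using h'(2) r by linarith
      qed
    qed (use r x \<open>0 \<le> H\<close> in auto)
  qed
qed

section \<open>Regions of the letters\<close>

text \<open>One formula per letter replaces the three cases of \<open>cuts\<close> and
  \<open>word\<close>: for \<open>t\<close> in \<open>[-1, 1]\<close> inequalities that do not apply
  become vacuous or unsatisfiable. The regions therefore need no case split at
  \<open>t = P - 1\<close> and \<open>t = 1 - P\<close>.\<close>

fun base_region :: "real \<Rightarrow> letter \<Rightarrow> real \<Rightarrow> real \<Rightarrow> bool" where
  "base_region P North t v \<longleftrightarrow> - 1 < v \<and> v < P - 1 \<and> v < t \<and> t + P - 2 < v"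
| "base_region P South t v \<longleftrightarrow> 1 - P < v \<and> v < 1 \<and> t < v \<and> v < t + 2 - P"
| "base_region P East t v \<longleftrightarrow> t < v \<and> v < 1 - P \<or> - 1 < v \<and> v < t + P - 2"
| "base_region P West t v \<longleftrightarrow> t + 2 - P < v \<and> v < 1 \<or> P - 1 < v \<and> v < t"

text \<open>Quantifying over all translates, instead of using \<open>rep2\<close>, makes
  periodicity, reflection and openness accessible without floors.\<close>

definition region :: "real \<Rightarrow> letter \<Rightarrow> real \<Rightarrow> real \<Rightarrow> bool" where
  "region P l t u \<longleftrightarrow> (\<exists>i. base_region P l t (u - 2 * of_int i))"

section \<open>Translations and reflections between letter regions\<close>

lemma region_periodic:
  assumes "u' = u + 2 * of_int j"
  shows "region P l t u' \<longleftrightarrow> region P l t u"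
proof -
  have "u' - 2 * of_int (i + j) = u - 2 * of_int i" "u - 2 * of_int (i - j) = u' - 2 * of_int i" for i
    by (auto simp: assms)
  then show ?thesis
    unfolding region_def by metis
qed

lemma region_shift:
  assumes "\<And>v. base_region P l t v \<longleftrightarrow> base_region P l' t' (v + s)"
  shows "region P l t u \<longleftrightarrow> region P l' t' (u + s)"
  using assms[of "u - 2 * of_int _"] by (simp add: region_def add_diff_eq diff_add_eq)

lemma region_reflect:
  "region P l t u \<longleftrightarrow> region P (opp l) (- t) (- u)"
proof -
  have b: "base_region P l t v \<longleftrightarrow> base_region P (opp l) (- t) (- v)" for v
    by (cases l) auto
  have *: "- u - 2 * of_int (- i) = - (u - 2 * of_int i)" for i
    by simp
  show ?thesis
    unfolding region_def using b * by (metis minus_minus)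
qed

text \<open>The South interval is the North interval translated by \<open>2 - P\<close>. This
  governs crossings of horizontal edges.\<close>

lemma region_North_South: "region P North t u \<longleftrightarrow> region P South t (u - P)"
proof -
  have "region P North t u \<longleftrightarrow> region P South t (u + (2 - P))"
    by (rule region_shift) auto
  also have "\<dots> \<longleftrightarrow> region P South t (u - P)"
    by (rule region_periodic[where j = 1]) simp
  finally show ?thesis .
qed

text \<open>This governs crossings of vertical edges when the time leaves \<open>[-1, 1)\<close> and
  is moved back by \<open>2\<close>, which also takes \<open>P\<close> off the shift
  \<open>2 * P\<close> of the argument.\<close>

lemma region_East_West: "region P East t u \<longleftrightarrow> region P West (t + 2 * P - 2) (u + P)"
  by (rule region_shift) auto


lemma rep2_bounds: "- 1 \<le> rep2 u \<and> rep2 u < 1"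
  using floor_correct[of "(u + 1) / 2"] by (simp add: rep2_def field_simps)

lemma region_rep2:
  assumes "0 < P" "P < 1" "- 1 \<le> t" "t \<le> 1"
  shows "region P l t u \<longleftrightarrow> base_region P l t (rep2 u)"
proof
  assume "region P l t u"
  then obtain i where i: "base_region P l t (u - 2 * of_int i)"
    by (auto simp: region_def)
  then have "- 1 < u - 2 * of_int i" "u - 2 * of_int i < 1"
    using assms by (cases l; auto)+
  then have "\<lfloor>(u + 1) / 2\<rfloor> = i"
    by (simp add: floor_eq_iff field_simps)
  then show "base_region P l t (rep2 u)"
    using i by (simp add: rep2_def)
qed (auto simp: region_def rep2_def)

lemma col_eq_Some_iff:
  assumes "0 < P" "P < 1" "- 1 \<le> t" "t \<le> 1"
  shows "col P t u = Some l \<longleftrightarrow> region P l t u"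
  unfolding region_rep2[OF assms] using assms rep2_bounds[of u]
  by (cases l) (auto simp: col_def cuts_def word_def Let_def split: if_splits)

lemma open_region:
  fixes f g :: "'a::topological_space \<Rightarrow> real"
  assumes "continuous_on UNIV f" "continuous_on UNIV g"
  shows "open {q. region P l (f q) (g q)}"
proof -
  have "open {q. base_region P l (f q) (g q - 2 * of_int i)}" for i
    using assms
    by (cases l) (auto intro!: open_Collect_conj open_Collect_disj open_Collect_less continuous_intros)
  then show ?thesis
    by (simp add: region_def open_Collect_ex)
qed

text \<open>Every cut point differs from \<open>0\<close> or from \<open>t\<close> by an integer
  combination of \<open>P\<close> and \<open>1\<close>, so the two non-membership assumptions keep
  \<open>u\<close> away from all cuts modulo 2.\<close>

lemma region_exists:
  assumes "0 < P" "P < 1" "- 1 \<le> t" "t < 1"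
    and "\<And>a b::int. u \<noteq> P * of_int a + of_int b" "\<And>a b::int. u - t \<noteq> P * of_int a + of_int b"
  shows "\<exists>l. region P l t u"
proof -
  define n where "n = 2 * \<lfloor>(u + 1) / 2\<rfloor>"
  have u: "rep2 u = u - of_int n"
    by (simp add: rep2_def n_def)
  have "rep2 u \<noteq> -1" "rep2 u \<noteq> 1 - P" "rep2 u \<noteq> P - 1"
    using assms(5)[of 0 "n - 1"] assms(5)[of "-1" "n + 1"] assms(5)[of 1 "n - 1"] by (auto simp: u)
  moreover have "rep2 u \<noteq> t" "rep2 u \<noteq> t + 2 - P" "rep2 u \<noteq> t + P - 2"
    using assms(6)[of 0 n] assms(6)[of "-1" "n + 2"] assms(6)[of 1 "n - 2"] by (auto simp: u)
  ultimately have "\<exists>l. base_region P l t (rep2 u)"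
    using assms(1-4) rep2_bounds[of u]
    by (metis (no_types, lifting) base_region.simps linorder_neqE_linordered_idom linorder_not_le)
  then show ?thesis
    using region_rep2 assms(1-4) by simp
qed

section \<open>The symmetric tiling\<close>

lemma flip_NS_opp: "flip_NS (opp l) = opp (flip_NS l)"
  by (cases l) auto

text \<open>The times \<open>-1\<close> and \<open>1\<close> describe the same slice under the
  half-period \<open>(2, P, P)\<close>; passing from one description to the other interchanges East
  and West.\<close>

lemma region_boundary:
  assumes "l = East \<or> l = West" "0 < P" "P < 1"
  shows "region P l (- 1) u \<longleftrightarrow> region P (opp l) 1 (u + P)"
proof (cases l)
  case East
  have "region P East (- 1) u \<longleftrightarrow> region P West 1 (u + P)"
    using assms by (intro region_shift) auto
  then show ?thesis
    by (simp add: East)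
next
  case West
  have "region P West (- 1) u \<longleftrightarrow> region P East 1 (u + (P - 2))"
    using assms by (intro region_shift) auto
  also have "\<dots> \<longleftrightarrow> region P East 1 (u + P)"
    by (rule region_periodic[where j = "- 1"]) simp
  finally show ?thesis
    by (simp add: West)
qed (use assms in auto)

text \<open>This is the vertical edge without a half-period: pulled back by \<open>2 * P\<close>,
  the West interval \<open>(P - 1, t + 2 * P)\<close> becomes, modulo 2, the interval
  \<open>(1 - P, t + 2)\<close>, which up to endpoints is the complement of the East interval
  \<open>(t, 1 - P)\<close>.\<close>

lemma region_East_West_complement:
  assumes "0 < P" "P < 1" "- 1 \<le> t" "t + 2 * P < 1"
    and "\<And>a b::int. u \<noteq> P * of_int a + of_int b" "\<And>a b::int. u - t \<noteq> P * of_int a + of_int b"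
  shows "region P West (t + 2 * P) (u + 2 * P) \<longleftrightarrow> \<not> region P East t u"
proof -
  define n where "n = \<lfloor>(u + 1) / 2\<rfloor>"
  have r: "rep2 u = u - 2 * of_int n"
    by (simp add: rep2_def n_def)
  have E: "region P East t u \<longleftrightarrow> t < rep2 u \<and> rep2 u < 1 - P"
    using assms rep2_bounds[of u] by (subst region_rep2) auto
  show ?thesis
  proof
    assume "\<not> region P East t u"
    moreover have "rep2 u \<noteq> t" "rep2 u \<noteq> 1 - P"
      using assms(5)[of "- 1" "2 * n + 1"] assms(6)[of 0 "2 * n"] by (auto simp: r)
    ultimately consider "rep2 u < t" | "1 - P < rep2 u"
      unfolding E by linarith
    then show "region P West (t + 2 * P) (u + 2 * P)"
    proof cases
      case 1
      then have "base_region P West (t + 2 * P) (u + 2 * P - 2 * of_int n)"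
        using rep2_bounds[of u] assms by (auto simp: r)
      then show ?thesis
        unfolding region_def by blast
    next
      case 2
      then have "base_region P West (t + 2 * P) (u + 2 * P - 2 * of_int (n + 1))"
        using rep2_bounds[of u] assms by (auto simp: r)
      then show ?thesis
        unfolding region_def by blast
    qed
  next
    assume "region P West (t + 2 * P) (u + 2 * P)"
    then obtain i where i: "base_region P West (t + 2 * P) (u + 2 * P - 2 * of_int i)"
      by (auto simp: region_def)
    define j where "j = i - n"
    have j: "P - 1 < rep2 u + 2 * P - 2 * of_int j" "rep2 u + 2 * P - 2 * of_int j < t + 2 * P"
      using i assms by (auto simp: r j_def)
    show "\<not> region P East t u"
    proof
      assume "region P East t u"
      then have *: "t < rep2 u" "rep2 u < 1 - P"
        unfolding E by auto
      then have "0 < real_of_int j"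
        using j by linarith
      then have "1 \<le> real_of_int j"
        by simp
      then show False
        using j * by linarith
    qed
  qed
qed

locale irrational_parameter =
  fixes P :: real
  assumes P_pos: "0 < P" and P_less_1: "P < 1" and P_irrational: "P \<notin> \<rat>"
begin

text \<open>The square \<open>(x, y)\<close> carries the point \<open>(1, P/2, P/2 + 1) + x(2P, 2P, 2P) + y(2, 0, 2P)\<close>; its
  time coordinate is \<open>time x + 2 turn x y\<close>, and \<open>ucol\<close>, \<open>urow\<close> are the arguments of the
  column and row letters after moving it back by \<open>turn x y\<close> half-periods.\<close>

definition time :: "int \<Rightarrow> real" where
  "time x = 2 * P * of_int x - 2 * of_int \<lfloor>P * of_int x\<rfloor> - 1"

definition turn :: "int \<Rightarrow> int \<Rightarrow> int" where
  "turn x y = 1 + y + \<lfloor>P * of_int x\<rfloor>"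

definition ucol :: "int \<Rightarrow> int \<Rightarrow> real" where
  "ucol x y = P / 2 + 2 * P * of_int x - P * of_int (turn x y)"

definition urow :: "int \<Rightarrow> int \<Rightarrow> real" where
  "urow x y = P / 2 + 1 + 2 * P * of_int x + 2 * P * of_int y - P * of_int (turn x y)"

definition cletter :: "int \<Rightarrow> int \<Rightarrow> letter" where
  "cletter x y = the (col P (time x) (ucol x y))"

definition rletter :: "int \<Rightarrow> int \<Rightarrow> letter" where
  "rletter x y = the (col P (time x) (urow x y))"

definition inn :: "int \<times> int \<Rightarrow> letter" where
  "inn = (\<lambda>(x, y). if even (turn x y) then cletter x y else flip_NS (rletter x y))"

definition out :: "int \<times> int \<Rightarrow> letter" where
  "out = (\<lambda>(x, y). if even (turn x y) then flip_NS (rletter x y) else cletter x y)"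

lemma time_bounds: "- 1 \<le> time x \<and> time x < 1"
  unfolding time_def mult.assoc using floor_correct[of "P * of_int x"] by linarith

text \<open>The offset \<open>P / 2\<close> of the starting point keeps the orbit off the cuts: an
  equality would make an odd multiple of \<open>P\<close> an integer.\<close>

lemma half_odd_multiple:
  assumes "u = P / 2 + P * of_int c + of_int d"
  shows "u \<noteq> P * of_int a + of_int b"
proof
  assume "u = P * of_int a + of_int b"
  then have "P * of_int (1 + 2 * (c - a)) = of_int (2 * (b - d))"
    using assms by (simp add: algebra_simps)
  then have "1 + 2 * (c - a) = 0"
    by (rule irrational_multiple[OF P_irrational])
  then show False
    by presburger
qed

lemma generic:
  "ucol x y \<noteq> P * of_int a + of_int b" "ucol x y - time x \<noteq> P * of_int a + of_int b"
  "urow x y \<noteq> P * of_int a + of_int b" "urow x y - time x \<noteq> P * of_int a + of_int b"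
proof -
  show "ucol x y \<noteq> P * of_int a + of_int b"
    by (rule half_odd_multiple[where c = "2 * x - turn x y" and d = 0])
       (simp add: ucol_def algebra_simps)
  show "ucol x y - time x \<noteq> P * of_int a + of_int b"
    by (rule half_odd_multiple[where c = "- turn x y" and d = "2 * \<lfloor>P * of_int x\<rfloor> + 1"])
       (simp add: ucol_def time_def algebra_simps)
  show "urow x y \<noteq> P * of_int a + of_int b"
    by (rule half_odd_multiple[where c = "2 * x + 2 * y - turn x y" and d = 1])
       (simp add: urow_def algebra_simps)
  show "urow x y - time x \<noteq> P * of_int a + of_int b"
    by (rule half_odd_multiple[where c = "2 * y - turn x y" and d = "2 * \<lfloor>P * of_int x\<rfloor> + 2"])
       (simp add: urow_def time_def algebra_simps)
qed

lemma col_eq_cletter: "col P (time x) (ucol x y) = Some (cletter x y)"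
  and col_eq_rletter: "col P (time x) (urow x y) = Some (rletter x y)"
proof -
  have t: "- 1 \<le> time x" "time x < 1" "time x \<le> 1"
    using time_bounds[of x] by auto
  show "col P (time x) (ucol x y) = Some (cletter x y)"
    using region_exists[OF P_pos P_less_1 t(1,2) generic(1,2)] col_eq_Some_iff[OF P_pos P_less_1 t(1,3)]
    by (auto simp: cletter_def)
  show "col P (time x) (urow x y) = Some (rletter x y)"
    using region_exists[OF P_pos P_less_1 t(1,2) generic(3,4)] col_eq_Some_iff[OF P_pos P_less_1 t(1,3)]
    by (auto simp: rletter_def)
qed

lemma cletter_eq_iff: "cletter x y = l \<longleftrightarrow> region P l (time x) (ucol x y)"
  and rletter_eq_iff: "rletter x y = l \<longleftrightarrow> region P l (time x) (urow x y)"
  using col_eq_Some_iff[OF P_pos P_less_1, of "time x"] time_bounds[of x] col_eq_cletter col_eq_rletter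
  by (auto simp: less_imp_le simp flip: col_eq_Some_iff[OF P_pos P_less_1])

section \<open>Matching of tiles across their edges\<close>

lemma north_edge:
  "cletter x (y + 1) = South \<longleftrightarrow> cletter x y = North"
  "rletter x (y + 1) = North \<longleftrightarrow> rletter x y = South"
proof -
  have "ucol x (y + 1) = ucol x y - P" "urow x (y + 1) = urow x y + P"
    by (auto simp: ucol_def urow_def turn_def algebra_simps)
  then show "cletter x (y + 1) = South \<longleftrightarrow> cletter x y = North"
    "rletter x (y + 1) = North \<longleftrightarrow> rletter x y = South"
    by (simp_all add: cletter_eq_iff rletter_eq_iff region_North_South)
qed

text \<open>The floor of \<open>P * x\<close> either stays or grows by one. In the first case the
  roles of column and row are kept and East turns into the complement of West; in the second the
  roles are exchanged and East turns into West. If exactly one of the two letters is East, both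
  cases turn an exit East into an entrance West, and the new exit is not West.\<close>

lemma east_edge:
  "even (turn (x + 1) y) = even (turn x y) \<and>
     (cletter (x + 1) y = West \<longleftrightarrow> cletter x y \<noteq> East) \<and>
     (rletter (x + 1) y = West \<longleftrightarrow> rletter x y \<noteq> East) \<or>
   even (turn (x + 1) y) \<noteq> even (turn x y) \<and>
     (cletter (x + 1) y = West \<longleftrightarrow> cletter x y = East) \<and>
     (rletter (x + 1) y = West \<longleftrightarrow> rletter x y = East)"
proof -
  have "P * of_int (x + 1) = P * of_int x + P"
    by (simp add: algebra_simps)
  then have "\<lfloor>P * of_int x\<rfloor> \<le> \<lfloor>P * of_int (x + 1)\<rfloor>" "\<lfloor>P * of_int (x + 1)\<rfloor> < \<lfloor>P * of_int x\<rfloor> + 2"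
    unfolding le_floor_iff floor_less_iff
    using P_pos P_less_1 floor_correct[of "P * of_int x"] by linarith+
  then have "\<lfloor>P * of_int (x + 1)\<rfloor> = \<lfloor>P * of_int x\<rfloor> \<or> \<lfloor>P * of_int (x + 1)\<rfloor> = \<lfloor>P * of_int x\<rfloor> + 1"
    by linarith
  then show ?thesis
  proof
    assume "\<lfloor>P * of_int (x + 1)\<rfloor> = \<lfloor>P * of_int x\<rfloor>"
    then have "time (x + 1) = time x + 2 * P" "turn (x + 1) y = turn x y"
      by (auto simp: time_def turn_def algebra_simps)
    moreover from this have "ucol (x + 1) y = ucol x y + 2 * P" "urow (x + 1) y = urow x y + 2 * P"
      by (auto simp: ucol_def urow_def algebra_simps)
    ultimately show ?thesis
      using time_bounds[of x] time_bounds[of "x + 1"] generic[of x y] P_pos P_less_1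
      by (simp add: cletter_eq_iff rletter_eq_iff region_East_West_complement)
  next
    assume "\<lfloor>P * of_int (x + 1)\<rfloor> = \<lfloor>P * of_int x\<rfloor> + 1"
    then have "time (x + 1) = time x + 2 * P - 2" and t: "turn (x + 1) y = turn x y + 1"
      by (auto simp: time_def turn_def algebra_simps)
    moreover from this have "ucol (x + 1) y = ucol x y + P" "urow (x + 1) y = urow x y + P"
      by (auto simp: ucol_def urow_def algebra_simps)
    ultimately show ?thesis
      by (simp add: cletter_eq_iff rletter_eq_iff region_East_West)
  qed
qed

lemma inn_out_match:
  assumes "inn a \<noteq> out a"
  shows "inn (a + dir (out a)) = opp (out a) \<and> out (a + dir (out a)) \<noteq> opp (out a)"
proof -
  obtain x y where a: "a = (x, y)"
    by force
  have tN: "even (turn x (y + 1)) \<longleftrightarrow> odd (turn x y)" "even (turn x y) \<longleftrightarrow> odd (turn x (y - 1))"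
    by (auto simp: turn_def)
  have flips: "flip_NS l = North \<longleftrightarrow> l = South" "flip_NS l = South \<longleftrightarrow> l = North"
     "flip_NS l = East \<longleftrightarrow> l = East" "flip_NS l = West \<longleftrightarrow> l = West" for l
    by (cases l; simp)+
  show ?thesis
  proof (cases "out a")
    case North
    then show ?thesis
      using assms tN(1) north_edge[of x y] by (auto simp: a inn_def out_def flips split: if_splits)
  next
    case South
    then show ?thesis
      using assms tN(2) north_edge[of x "y - 1"] by (auto simp: a inn_def out_def flips split: if_splits)
  next
    case East
    then show ?thesis
      using assms east_edge[of x y] by (auto simp: a inn_def out_def flips split: if_splits)
  next
    case West
    then show ?thesis
      using assms east_edge[of "x - 1" y] by (auto simp: a inn_def out_def flips split: if_splits)
  qed
qed

section \<open>Central symmetry of the tiling\<close>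

lemma inn_out_sym:
  assumes "inn a \<noteq> out a"
  shows "inn (- a) = opp (out a) \<and> out (- a) = opp (inn a)"
proof -
  obtain x y where a: "a = (x, y)"
    by force
  show ?thesis
  \<comment> \<open>Reflection sends \<open>time x\<close> to \<open>- time x\<close>, which stays
    in \<open>[-1, 1)\<close> except when \<open>time x = -1\<close>, that is, for
    \<open>x = 0\<close>. There the reflected time \<open>1\<close> is brought back to
    \<open>-1\<close> by \<open>region_boundary\<close>.\<close>
  proof (cases "x = 0")
    case True
    have turn: "even (turn 0 (- y)) \<longleftrightarrow> even (turn 0 y)"
      by (simp add: turn_def)
    have t: "time 0 = - 1"
      by (simp add: time_def)
    have refl: "region P l (- 1) (- u - P) \<longleftrightarrow> region P l (- 1) u" if "l = East \<or> l = West" for l u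
      using region_boundary[OF that P_pos P_less_1, of "- u - P"] region_reflect[of P l "- 1" u] by simp
    have EW: "l = East \<or> l = West" if "region P l (- 1) u" for l u
      using that P_pos P_less_1 by (cases l) (auto simp: region_def)
    have EW': "cletter 0 y = East \<or> cletter 0 y = West" "rletter 0 y = East \<or> rletter 0 y = West"
      using EW cletter_eq_iff[of 0 y] rletter_eq_iff[of 0 y] by (auto simp: t)
    have "ucol 0 (- y) = - ucol 0 y - P"
      by (simp add: ucol_def turn_def algebra_simps)
    then have c: "cletter 0 (- y) = cletter 0 y"
      using refl[OF EW'(1)] cletter_eq_iff[of 0 y "cletter 0 y"] by (simp add: cletter_eq_iff t)
    have "urow 0 (- y) = - urow 0 y - P + 2 * of_int 1"
      by (simp add: urow_def turn_def algebra_simps)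
    from region_periodic[OF this] have r: "rletter 0 (- y) = rletter 0 y"
      using refl[OF EW'(2)] rletter_eq_iff[of 0 y "rletter 0 y"]
      by (simp add: rletter_eq_iff t)
    \<comment> \<open>On this column only East and West occur and the reflected tile has the same
      letters; an active tile has one of each, so each letter is the opposite of the other.\<close>
    show ?thesis
      using EW' assms turn c r by (auto simp: a inn_def out_def True)
  next
    case False
    have "P * of_int x \<noteq> of_int m" for m
      using irrational_multiple[OF P_irrational] False by blast
    then have "of_int \<lfloor>P * of_int x\<rfloor> < P * of_int x"
      by (metis floor_correct order_le_less)
    moreover have "P * of_int x < of_int \<lfloor>P * of_int x\<rfloor> + 1" "P * of_int (- x) = - (P * of_int x)"
      by auto
    \<comment> \<open>The extra \<open>- 1\<close>, due to \<open>P * x\<close> not being an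
      integer, flips the parity of \<open>turn\<close> and so exchanges entrance and exit.\<close>
    ultimately have fl: "\<lfloor>P * of_int (- x)\<rfloor> = - \<lfloor>P * of_int x\<rfloor> - 1"
      unfolding floor_eq_iff by linarith
    then have t: "time (- x) = - time x" and turn: "turn (- x) (- y) = 1 - turn x y"
      by (auto simp: time_def turn_def)
    have c: "cletter (- x) (- y) = opp (cletter x y)"
    proof -
      have "ucol (- x) (- y) = - ucol x y"
        by (simp add: ucol_def turn algebra_simps)
      then show ?thesis
        using cletter_eq_iff[of x y "cletter x y"]
          region_reflect[of P "cletter x y" "time x" "ucol x y"] by (simp add: cletter_eq_iff t)
    qed
    have r: "rletter (- x) (- y) = opp (rletter x y)"
    proof -
      have "urow (- x) (- y) = - urow x y + 2 * of_int 1"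
        by (simp add: urow_def turn algebra_simps)
      from region_periodic[OF this] show ?thesis
        using rletter_eq_iff[of x y "rletter x y"]
          region_reflect[of P "rletter x y" "time x" "urow x y"] by (simp add: rletter_eq_iff t)
    qed
    show ?thesis
      by (simp add: a inn_def out_def turn c r flip_NS_opp)
  qed
qed

lemma inn_out_start: "inn 0 = West" "out 0 = East"
proof -
  have "base_region P East (- 1) (- P / 2 - 2 * of_int 0)" "base_region P West (- 1) (1 - P / 2 - 2 * of_int 0)"
    using P_pos P_less_1 by auto
  then have "region P East (- 1) (- P / 2)" "region P West (- 1) (1 - P / 2)"
    unfolding region_def by blast+
  moreover have "time 0 = - 1" "ucol 0 0 = - P / 2" "urow 0 0 = 1 - P / 2"
    by (auto simp: time_def ucol_def urow_def turn_def field_simps)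
  ultimately have "cletter 0 0 = East" "rletter 0 0 = West"
    by (auto simp: cletter_eq_iff rletter_eq_iff)
  then show "inn 0 = West" "out 0 = East"
    by (auto simp: inn_def out_def turn_def zero_prod_def)
qed

sublocale symmetric_tiling inn out
  by unfold_locales (auto simp: inn_out_match inn_out_sym inn_out_start)

end

section \<open>Grid lines without nearby crossings\<close>

text \<open>A perturbation smaller than the distance to both endpoints modulo 2 cannot change
  membership.\<close>

lemma interval_mod2_close:
  fixes u u' lo hi :: real
  assumes "\<bar>u' - u - 2 * of_int j\<bar> < \<epsilon>"
    and "\<And>i::int. \<epsilon> \<le> \<bar>u - 2 * of_int i - lo\<bar>" "\<And>i::int. \<epsilon> \<le> \<bar>u - 2 * of_int i - hi\<bar>"
  shows "(\<exists>i::int. lo < u - 2 * of_int i \<and> u - 2 * of_int i < hi)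
     \<longleftrightarrow> (\<exists>i::int. lo < u' - 2 * of_int i \<and> u' - 2 * of_int i < hi)"
proof
  assume "\<exists>i::int. lo < u - 2 * of_int i \<and> u - 2 * of_int i < hi"
  then obtain i :: int where "lo < u - 2 * of_int i" "u - 2 * of_int i < hi"
    by blast
  then have "lo < u' - 2 * of_int (i + j) \<and> u' - 2 * of_int (i + j) < hi"
    using assms(1) assms(2,3)[of i] by (auto simp: abs_le_iff abs_less_iff)
  then show "\<exists>i::int. lo < u' - 2 * of_int i \<and> u' - 2 * of_int i < hi"
    by blast
next
  assume "\<exists>i::int. lo < u' - 2 * of_int i \<and> u' - 2 * of_int i < hi"
  then obtain i :: int where "lo < u' - 2 * of_int i" "u' - 2 * of_int i < hi"
    by blast
  then have "lo < u - 2 * of_int (i - j) \<and> u - 2 * of_int (i - j) < hi"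
    using assms(1) assms(2,3)[of "i - j"] by (auto simp: abs_if split: if_splits)
  then show "\<exists>i::int. lo < u - 2 * of_int i \<and> u - 2 * of_int i < hi"
    by blast
qed

lemma region_North_iff:
  "region P North t u \<longleftrightarrow>
     (\<exists>i. max (- 1) (t + P - 2) < u - 2 * of_int i \<and> u - 2 * of_int i < min t (P - 1))"
  by (auto simp: region_def)

context irrational_parameter
begin

text \<open>On the horizontal line above row \<open>y\<close>, the column and row intervals that produce crossings
  coincide up to a translation by \<open>P (2y + 1) - 1\<close> modulo 2. When that is small, all crossings
  are far away from the vertical axis.\<close>

lemma empty_row:
  "\<exists>y\<ge>0. \<forall>x. \<bar>x\<bar> \<le> M \<longrightarrow> (cletter x y = North \<longleftrightarrow> rletter x y = South)"
proof -
  \<comment> \<open>For each \<open>x\<close> there are four indices, one for each possible endpoint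
    of the North interval: twice the distance from \<open>ucol x y\<close> to that endpoint is
    \<open>\<bar>2 * P * k + 1 - 2 * m\<bar>\<close> up to the small error
    \<open>\<eta>\<close>.\<close>
  define K where "K = (\<Union>x\<in>{-M..M}. {\<lfloor>P * of_int x\<rfloor>, \<lfloor>P * of_int x\<rfloor> + 1,
    2 * x - \<lfloor>P * of_int x\<rfloor>, 2 * x - \<lfloor>P * of_int x\<rfloor> - 1})"
  define S where "S = (\<lambda>k. 2 * P * of_int k + 1) ` K"
  have "\<exists>\<epsilon>>0. \<forall>s\<in>S. \<forall>m. \<epsilon> \<le> \<bar>s - 2 * of_int m\<bar>"
  proof (rule finite_away_from_even)
    fix s m
    assume "s \<in> S"
    show "s \<noteq> 2 * of_int m"
    proof
      assume "s = 2 * of_int m"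
      moreover obtain k where "s = 2 * P * of_int k + 1"
        using \<open>s \<in> S\<close> unfolding S_def by blast
      ultimately have "P * of_int (2 * k) = of_int (2 * m - 1)"
        by simp
      moreover have "2 * m - 1 \<noteq> 0"
        by presburger
      ultimately show False
        using irrational_multiple[OF P_irrational, of "2 * k" "2 * m - 1"] by auto
    qed
  qed (auto simp: S_def K_def)
  then obtain \<epsilon> where "\<epsilon> > 0" and "\<And>s m. s \<in> S \<Longrightarrow> \<epsilon> \<le> \<bar>s - 2 * of_int m\<bar>"
    by blast
  then have \<epsilon>: "\<epsilon> \<le> \<bar>2 * P * of_int k + 1 - 2 * of_int m\<bar>" if "k \<in> K" for k m
    using that by (auto simp: S_def)
  \<comment> \<open>The quantity made small is the discrepancy modulo 2 between
    \<open>urow x y + P\<close> and \<open>ucol x y\<close>. The bound \<open>\<epsilon>\<close> was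
    fixed before \<open>y\<close>, and depends only on \<open>M\<close> and
    \<open>P\<close>.\<close>
  obtain y h where y: "y \<ge> 0" "\<bar>2 * P * of_int y + (1 + P) - 2 * of_int h\<bar> < \<epsilon> / 3"
    using int_multiple_approx[OF P_irrational, of "\<epsilon> / 3" "1 + P"] \<open>\<epsilon> > 0\<close> by auto
  define \<eta> where "\<eta> = 2 * P * of_int y + (1 + P) - 2 * of_int h"
  have \<eta>: "\<bar>\<eta>\<bar> < \<epsilon> / 3"
    using y by (simp add: \<eta>_def)
  have "cletter x y = North \<longleftrightarrow> rletter x y = South" if x: "\<bar>x\<bar> \<le> M" for x
  proof -
    define n where "n = \<lfloor>P * of_int x\<rfloor>"
    have "x \<in> {-M..M}"
      using x by auto
    then have "{n, n + 1, 2 * x - n, 2 * x - n - 1} \<subseteq> K"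
      unfolding K_def n_def by blast
    then have k: "\<epsilon> \<le> \<bar>2 * P * of_int n + 1 - 2 * of_int m\<bar>"
      "\<epsilon> \<le> \<bar>2 * P * of_int (n + 1) + 1 - 2 * of_int m\<bar>"
      "\<epsilon> \<le> \<bar>2 * P * of_int (2 * x - n) + 1 - 2 * of_int m\<bar>"
      "\<epsilon> \<le> \<bar>2 * P * of_int (2 * x - n - 1) + 1 - 2 * of_int m\<bar>" for m
      using \<epsilon> by blast+
    have away: "\<epsilon> / 3 \<le> \<bar>a\<bar>" if "2 * a = - b - \<eta> \<or> 2 * a = b - \<eta>" "\<epsilon> \<le> \<bar>b\<bar>" for a b
      using that \<eta> by linarith
    \<comment> \<open>Doubling allows \<open>y\<close> to be eliminated in favour of
      \<open>\<eta>\<close> and \<open>h\<close>, so that distances to endpoints depend on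
      \<open>x\<close> alone up to \<open>\<eta>\<close>.\<close>
    have u: "2 * ucol x y = - P + 4 * P * of_int x - 2 * P * of_int n - \<eta> + 1 + P - 2 * of_int h"
      by (simp add: ucol_def turn_def \<eta>_def n_def algebra_simps)
    have t: "time x = 2 * P * of_int x - 2 * of_int n - 1"
      by (simp add: time_def n_def)
    have 1: "\<epsilon> / 3 \<le> \<bar>ucol x y - 2 * of_int i - time x\<bar>" for i
      by (rule away[OF disjI1 k(1)[of "2 * n + 2 - h - 2 * i"]]) (simp add: u t algebra_simps)
    have 2: "\<epsilon> / 3 \<le> \<bar>ucol x y - 2 * of_int i - (time x + P - 2)\<bar>" for i
      by (rule away[OF disjI1 k(2)[of "2 * n + 4 - h - 2 * i"]]) (simp add: u t algebra_simps)
    have 3: "\<epsilon> / 3 \<le> \<bar>ucol x y - 2 * of_int i - (- 1)\<bar>" for i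
      by (rule away[OF disjI2 k(3)[of "h + 2 * i - 1"]]) (simp add: u t algebra_simps)
    have 4: "\<epsilon> / 3 \<le> \<bar>ucol x y - 2 * of_int i - (P - 1)\<bar>" for i
      by (rule away[OF disjI2 k(4)[of "h + 2 * i - 1"]]) (simp add: u t algebra_simps)
    have "urow x y + P - ucol x y - 2 * of_int h = \<eta>"
      by (simp add: urow_def ucol_def \<eta>_def algebra_simps)
    then have "region P North (time x) (ucol x y) \<longleftrightarrow> region P North (time x) (urow x y + P)"
      unfolding region_North_iff using \<eta> 1 2 3 4
      by (intro interval_mod2_close[where j = h and \<epsilon> = "\<epsilon> / 3"]) (auto simp: max_def min_def)
    then show ?thesis
      by (simp add: cletter_eq_iff rletter_eq_iff region_North_South)
  qed
  with y show ?thesis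
    by blast
qed

text \<open>If \<open>P * (2 * x + 1)\<close> is within \<open>e\<close> of \<open>2 * N\<close>,
  then \<open>time x = 1 - P + e\<close>, and at that time East occupies a single interval of length
  \<open>\<bar>e\<bar>\<close>, next to \<open>1 - P\<close> or next to \<open>-1\<close> according
  to the sign of \<open>e\<close>. It remains to choose \<open>x\<close> such that the arguments of
  the tiles near the horizontal axis miss this short interval.\<close>

lemma empty_column:
  "\<exists>x\<ge>0. \<forall>y. \<bar>y\<bar> \<le> M \<longrightarrow> cletter x y \<noteq> East \<and> rletter x y \<noteq> East"
proof (cases "0 \<le> M")
  case True
  \<comment> \<open>The bound \<open>P\<close> forces the floor of \<open>P * x\<close> to be
    \<open>N - 1\<close>. The odd numbers up to \<open>2 * M + 1\<close> cover
    \<open>2 * y - 1\<close>, \<open>- 2 * y - 1\<close> and their successors by \<open>2\<close>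
    for \<open>\<bar>y\<bar> \<le> M\<close>.\<close>
  obtain x N :: int where "x \<ge> 0" and small: "\<bar>P * (2 * of_int x + 1) - 2 * of_int N\<bar> < P"
    and far: "\<And>h m :: int. odd h \<Longrightarrow> \<bar>h\<bar> \<le> 2 * M + 1 \<Longrightarrow>
       2 * \<bar>P * (2 * of_int x + 1) - 2 * of_int N\<bar> \<le> \<bar>P * (2 * of_int N + of_int h) - 2 * of_int m\<bar>"
    using good_odd_multiple[OF P_irrational, of "2 * M + 1" P] True P_pos by auto
  define e where "e = P * (2 * of_int x + 1) - 2 * of_int N"
  have far': "2 * \<bar>e\<bar> \<le> \<bar>P * (2 * of_int N + of_int h) - 2 * of_int m\<bar>"
    if "odd h" "\<bar>h\<bar> \<le> 2 * M + 1" for h m :: int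
    unfolding e_def using far that by blast
  have Px: "P * of_int x = of_int N - P / 2 + e / 2"
    by (simp add: e_def field_simps)
  then have fl: "\<lfloor>P * of_int x\<rfloor> = N - 1"
    using small P_less_1 by (simp add: floor_eq_iff abs_less_iff flip: e_def)
  have t: "time x = 1 - P + e"
    by (simp add: time_def fl e_def algebra_simps)
  have no_East: "\<not> region P East (time x) u"
    if u: "2 * u - 2 * time x = 2 * of_int k - P * (2 * of_int N + of_int h)"
      and h: "odd h" "\<bar>h\<bar> \<le> 2 * M + 1" "\<bar>h + 2\<bar> \<le> 2 * M + 1" for u h k
  proof
    define Q where "Q = P * (2 * of_int N + of_int h)"
    have Q2: "P * (2 * of_int N + of_int (h + 2)) = Q + 2 * P"
      by (simp add: Q_def algebra_simps)
    assume "region P East (time x) u"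
    then obtain i where "base_region P East (time x) (u - 2 * of_int i)"
      by (auto simp: region_def)
    \<comment> \<open>In either component of the East region, \<open>P * (2 * N + h)\<close> or
      \<open>P * (2 * N + h + 2)\<close> would be closer than \<open>2 * \<bar>e\<bar>\<close> to an
      even integer.\<close>
    then consider "time x < u - 2 * of_int i" "u - 2 * of_int i < 1 - P"
      | "- 1 < u - 2 * of_int i" "u - 2 * of_int i < time x + P - 2"
      by auto
    then show False
    proof cases
      case 1
      then have "2 * of_int k - 4 * of_int i - Q > 0" "2 * of_int k - 4 * of_int i - Q < - 2 * e"
        using u[folded Q_def] t by linarith+
      then show False
        using far'[OF h(1,2), of "k - 2 * i"] by (simp add: abs_if flip: Q_def split: if_splits)
    next
      case 2
      then have "2 * of_int k - 4 * of_int i + 4 - Q - 2 * P < 0"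
        "2 * of_int k - 4 * of_int i + 4 - Q - 2 * P > - 2 * e"
        using u[folded Q_def] t by linarith+
      moreover have "odd (h + 2)"
        using h(1) by simp
      ultimately show False
        using far'[OF _ h(3), of "k - 2 * i + 2", unfolded Q2] by (simp add: abs_if split: if_splits)
    qed
  qed
  have "cletter x y \<noteq> East \<and> rletter x y \<noteq> East" if y: "\<bar>y\<bar> \<le> M" for y
  proof
    have "2 * ucol x y - 2 * time x = 2 * of_int (2 * N - 1) - P * (2 * of_int N + of_int (2 * y - 1))"
      by (simp add: ucol_def turn_def time_def fl algebra_simps)
    then show "cletter x y \<noteq> East"
      unfolding cletter_eq_iff by (rule no_East) (use y in auto)
    have "2 * urow x y - 2 * time x = 2 * of_int (2 * N) - P * (2 * of_int N + of_int (- 2 * y - 1))"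
      by (simp add: urow_def turn_def time_def fl algebra_simps)
    then show "rletter x y \<noteq> East"
      unfolding rletter_eq_iff by (rule no_East) (use y in auto)
  qed
  with \<open>x \<ge> 0\<close> show ?thesis
    by blast
qed (auto intro: exI[of _ 0])

lemma unbounded_path: "\<exists>n. M < \<bar>fst (path n)\<bar>" "\<exists>n. M < \<bar>snd (path n)\<bar>"
proof -
  have flips: "flip_NS l = North \<longleftrightarrow> l = South" "flip_NS l = East \<longleftrightarrow> l = East" for l
    by (cases l; simp)+
  have active_iff: "active (x, y) \<longleftrightarrow> cletter x y \<noteq> flip_NS (rletter x y)" for x y
    unfolding active_def by (auto simp: inn_def out_def)
  obtain y where "0 \<le> y" "\<And>x. \<bar>x\<bar> \<le> M \<Longrightarrow> cletter x y = North \<longleftrightarrow> rletter x y = South"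
    using empty_row by blast
  \<comment> \<open>The row letter is North exactly when \<open>rletter\<close> is South, so in this
    row a North side would be both entrance and exit, and the tile would be empty.\<close>
  then have "inn (x, y) \<noteq> North \<and> out (x, y) \<noteq> North" if "\<bar>x\<bar> \<le> M" "active (x, y)" for x
    using that unfolding active_iff by (auto simp: inn_def out_def flips)
  with \<open>0 \<le> y\<close> show "\<exists>n. M < \<bar>fst (path n)\<bar>"
    by (rule unbounded_fst)
  obtain x where "0 \<le> x" "\<And>y. \<bar>y\<bar> \<le> M \<Longrightarrow> cletter x y \<noteq> East \<and> rletter x y \<noteq> East"
    using empty_column by blast
  then show "\<exists>n. M < \<bar>snd (path n)\<bar>"
    by (intro unbounded_snd[of x]) (auto simp: inn_def out_def flips)
qed

end

section \<open>Labels of points of the quotient\<close>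

lemma lattice_iff:
  "w \<in> lattice P \<longleftrightarrow> (\<exists>a b c :: int. w = (4 * of_int a, 2 * P * of_int a + 2 * of_int b, 2 * P * of_int a + 2 * of_int c))"
  by (auto simp: lattice_def algebra_simps)

lemma lattice_uminus: "w \<in> lattice P \<Longrightarrow> - w \<in> lattice P"
proof -
  assume "w \<in> lattice P"
  then obtain a b c :: int
    where w: "w = (4 * of_int a, 2 * P * of_int a + 2 * of_int b, 2 * P * of_int a + 2 * of_int c)"
    by (auto simp: lattice_iff)
  show ?thesis
    unfolding lattice_iff by (intro exI[of _ "- a"] exI[of _ "- b"] exI[of _ "- c"]) (simp add: w)
qed

lemma lattice_add: "v \<in> lattice P \<Longrightarrow> w \<in> lattice P \<Longrightarrow> v + w \<in> lattice P"
proof -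
  assume "v \<in> lattice P" "w \<in> lattice P"
  then obtain a b c a' b' c' :: int
    where "v = (4 * of_int a, 2 * P * of_int a + 2 * of_int b, 2 * P * of_int a + 2 * of_int c)"
      "w = (4 * of_int a', 2 * P * of_int a' + 2 * of_int b', 2 * P * of_int a' + 2 * of_int c')"
    by (auto simp: lattice_iff)
  then show ?thesis
    unfolding lattice_iff
    by (intro exI[of _ "a + a'"] exI[of _ "b + b'"] exI[of _ "c + c'"]) (simp add: algebra_simps)
qed

lemma proj_eq_iff: "proj P p = proj P q \<longleftrightarrow> q - p \<in> lattice P"
proof
  assume "proj P p = proj P q"
  moreover have "(0 :: real \<times> real \<times> real) \<in> lattice P"
    unfolding lattice_iff by (intro exI[of _ 0]) (simp add: zero_prod_def)
  then have "q \<in> proj P q"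
    by (simp add: proj_def lattice_rel_def)
  ultimately show "q - p \<in> lattice P"
    by (auto simp: proj_def lattice_rel_def)
next
  assume qp: "q - p \<in> lattice P"
  have "w - p \<in> lattice P \<longleftrightarrow> w - q \<in> lattice P" for w
    using lattice_add[OF _ qp, of "w - q"] lattice_add[OF _ lattice_uminus[OF qp], of "w - p"] by auto
  then show "proj P p = proj P q"
    by (simp add: proj_def lattice_rel_def)
qed

lemma openin_proj_image:
  assumes "open V"
  shows "openin (XP_top P) (proj P ` V)"
proof -
  have "proj P -` (proj P ` V) = (\<Union>w\<in>lattice P. (+) w ` V)"
  proof (intro set_eqI iffI)
    fix p
    assume "p \<in> proj P -` (proj P ` V)"
    then obtain q where "q \<in> V" "proj P p = proj P q"
      by auto
    then have "q \<in> V" "p - q \<in> lattice P"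
      using proj_eq_iff[of P q p] by auto
    then show "p \<in> (\<Union>w\<in>lattice P. (+) w ` V)"
      by (intro UN_I[of "p - q"]) (auto intro: image_eqI[where x = q])
  next
    fix p
    assume "p \<in> (\<Union>w\<in>lattice P. (+) w ` V)"
    then obtain w q where "w \<in> lattice P" "q \<in> V" "p = w + q"
      by auto
    then have "proj P q = proj P p"
      by (simp add: proj_eq_iff)
    then show "p \<in> proj P -` (proj P ` V)"
      using \<open>q \<in> V\<close> by auto
  qed
  moreover have "open (\<Union>w\<in>lattice P. (+) w ` V)"
    using assms by (intro open_UN ballI open_translation)
  ultimately show ?thesis
    using range_proj[of P] by (auto simp: openin_XP_top)
qed

text \<open>Every point is moved into the strip \<open>-1 \<le> T < 1\<close> by multiples of \<open>(2, P, P)\<close>, each of which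
  exchanges the roles of the two letters.\<close>

definition half_turns :: "real \<times> real \<times> real \<Rightarrow> int" where
  "half_turns p = \<lfloor>(fst p + 1) / 2\<rfloor>"

definition regular :: "real \<Rightarrow> real \<times> real \<times> real \<Rightarrow> bool" where
  "regular P p \<longleftrightarrow> fst p - 2 * of_int (half_turns p) \<in> open_times P"

definition has_letters :: "real \<Rightarrow> real \<times> real \<times> real \<Rightarrow> letter \<Rightarrow> letter \<Rightarrow> bool" where
  "has_letters P = (\<lambda>(T, U1, U2) a b.
     let k = half_turns (T, U1, U2); t = T - 2 * of_int k;
         c = col P t (U1 - P * of_int k); r = row P t (U2 - P * of_int k)
     in if even k then c = Some a \<and> r = Some b else r = Some a \<and> c = Some b)"

lemma has_letters_unique:
  "has_letters P q a b \<Longrightarrow> has_letters P q a' b' \<Longrightarrow> a = a' \<and> b = b'"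
  by (cases q) (simp add: has_letters_def Let_def split: if_splits)

lemma rep2_periodic: "rep2 (u + 2 * of_int j) = rep2 u"
proof -
  have "(u + 2 * of_int j + 1) / 2 = (u + 1) / 2 + of_int j"
    by (simp add: field_simps)
  then have "\<lfloor>(u + 2 * of_int j + 1) / 2\<rfloor> = \<lfloor>(u + 1) / 2\<rfloor> + j"
    by (simp only: floor_add_int)
  then show ?thesis
    unfolding rep2_def by simp
qed

lemma col_periodic: "col P t (u + 2 * of_int j) = col P t u"
  by (simp add: col_def rep2_periodic)

text \<open>The generator \<open>(4, 2 * P, 2 * P)\<close> adds two half-turns, which preserves
  parity and is cancelled by the normalization; the other generators change only the arguments, by
  multiples of 2.\<close>

lemma lattice_invariant:
  assumes "proj P p = proj P q"
  shows "regular P p \<longleftrightarrow> regular P q" "has_letters P p a b \<longleftrightarrow> has_letters P q a b"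
proof -
  obtain T U1 U2 where p: "p = (T, U1, U2)"
    by (cases p)
  obtain i j l :: int where "q - p = (4 * of_int i, 2 * P * of_int i + 2 * of_int j, 2 * P * of_int i + 2 * of_int l)"
    using assms by (auto simp: proj_eq_iff lattice_iff)
  then have q: "q = (T + 4 * of_int i, U1 + 2 * P * of_int i + 2 * of_int j, U2 + 2 * P * of_int i + 2 * of_int l)"
    by (cases q) (auto simp: p algebra_simps)
  have "(T + 4 * of_int i + 1) / 2 = (T + 1) / 2 + of_int (2 * i)"
    by (simp add: field_simps)
  then have k: "half_turns q = half_turns p + 2 * i"
    unfolding half_turns_def p q fst_conv by (simp only: floor_add_int)
  show "regular P p \<longleftrightarrow> regular P q"
    unfolding regular_def k by (simp add: p q)
  have u: "u + 2 * P * of_int i + 2 * of_int m - P * of_int (half_turns p + 2 * i)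
       = u - P * of_int (half_turns p) + 2 * of_int m" for u m
    by (simp add: algebra_simps)
  have t: "T + 4 * of_int i - 2 * of_int (half_turns p + 2 * i) = T - 2 * of_int (half_turns p)"
    by simp
  show "has_letters P p a b \<longleftrightarrow> has_letters P q a b"
    using k unfolding has_letters_def p q prod.case Let_def row_def
    by (simp only: t[unfolded p] u[unfolded p] col_periodic even_add) simp
qed

lemma labelled_iff:
  assumes P: "0 < P" "P < 1"
  shows "proj P p \<in> labelled P \<xi> \<longleftrightarrow> regular P p \<and> (\<exists>a b. \<xi> = mk_label a b \<and> has_letters P p a b)"
proof
  assume "proj P p \<in> labelled P \<xi>"
  then obtain T U1 U2 a b where eq: "proj P p = proj P (T, U1, U2)" "\<xi> = mk_label a b" and
    *: "T \<in> open_times P \<and> col P T U1 = Some a \<and> row P T U2 = Some b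
         \<or> T - 2 \<in> open_times P \<and>
           row P (T - 2) (U2 - P) = Some a \<and> col P (T - 2) (U1 - P) = Some b"
    unfolding labelled_def by blast
  have "regular P (T, U1, U2) \<and> has_letters P (T, U1, U2) a b"
    using *
  proof
    assume *: "T \<in> open_times P \<and> col P T U1 = Some a \<and> row P T U2 = Some b"
    then have "half_turns (T, U1, U2) = 0"
      using P by (auto simp: half_turns_def open_times_def floor_eq_iff)
    then show ?thesis
      using * by (simp add: regular_def has_letters_def)
  next
    assume *: "T - 2 \<in> open_times P \<and>
           row P (T - 2) (U2 - P) = Some a \<and> col P (T - 2) (U1 - P) = Some b"
    then have "half_turns (T, U1, U2) = 1"
      using P by (auto simp: half_turns_def open_times_def floor_eq_iff)
    then show ?thesis
      using * by (simp add: regular_def has_letters_def)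
  qed
  then show "regular P p \<and> (\<exists>a b. \<xi> = mk_label a b \<and> has_letters P p a b)"
    using eq lattice_invariant[OF eq(1)] by blast
next
  assume R: "regular P p \<and> (\<exists>a b. \<xi> = mk_label a b \<and> has_letters P p a b)"
  then obtain a b where ab: "\<xi> = mk_label a b" "has_letters P p a b"
    by blast
  obtain T U1 U2 where p: "p = (T, U1, U2)"
    by (cases p)
  define k where "k = half_turns p"
  \<comment> \<open>Subtracting \<open>m\<close> times the first generator leaves \<open>0\<close>
    or \<open>1\<close> half-turns, the two alternatives in \<open>labelled\<close>.\<close>
  define m where "m = k div 2"
  define q where "q = (T - 4 * of_int m, U1 - 2 * P * of_int m, U2 - 2 * P * of_int m)"
  have "proj P q = proj P p"
    unfolding proj_eq_iff lattice_iff by (intro exI[of _ m] exI[of _ 0]) (simp add: p q_def)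
  have reg: "T - 2 * of_int k \<in> open_times P"
    using R by (simp add: regular_def p k_def)
  show "proj P p \<in> labelled P \<xi>"
  proof (cases "even k")
    case True
    then have "k = 2 * m"
      by (simp add: m_def)
    then have "T - 4 * of_int m \<in> open_times P \<and>
      col P (T - 4 * of_int m) (U1 - 2 * P * of_int m) = Some a \<and>
      row P (T - 4 * of_int m) (U2 - 2 * P * of_int m) = Some b"
      using reg ab(2) True by (simp add: has_letters_def p Let_def mult.left_commute mult.commute flip: k_def[unfolded p])
    then show ?thesis
      unfolding \<open>proj P q = proj P p\<close>[symmetric] labelled_def q_def using ab(1) by blast
  next
    case False
    then have k: "k = 2 * m + 1"
      by (simp add: m_def)
    have "P * of_int k = 2 * P * of_int m + P" "2 * real_of_int k = 4 * of_int m + 2"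
      by (simp_all add: k algebra_simps)
    then have "T - 4 * of_int m - 2 \<in> open_times P \<and>
      row P (T - 4 * of_int m - 2) (U2 - 2 * P * of_int m - P) = Some a \<and>
      col P (T - 4 * of_int m - 2) (U1 - 2 * P * of_int m - P) = Some b"
      using reg ab(2) False by (simp add: has_letters_def p Let_def diff_diff_eq flip: k_def[unfolded p])
    then show ?thesis
      unfolding \<open>proj P q = proj P p\<close>[symmetric] labelled_def q_def using ab(1) by blast
  qed
qed

section \<open>From locally constant letters to labels of quotient points\<close>

lemma regular_dense:
  assumes P: "0 < P" "P < 1" and "open W" "q \<in> W"
  shows "\<exists>p\<in>W. regular P p"
proof -
  \<comment> \<open>The times excluded by \<open>open_times\<close> form a countable set, which an
    arbitrarily small change of the first coordinate avoids.\<close>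
  define B where "B = (\<Union>i::int. {2 * of_int i - 1, P - 1 + 2 * of_int i, 1 - P + 2 * of_int i})"
  have "countable B"
    unfolding B_def by (intro countable_UN countable_insert countable_empty countableI_type)
  obtain \<epsilon> where "\<epsilon> > 0" and \<epsilon>: "ball q \<epsilon> \<subseteq> W"
    using assms(3,4) open_contains_ball by blast
  have "\<not> {fst q <..< fst q + \<epsilon>} \<subseteq> B"
    using countable_subset[OF _ \<open>countable B\<close>] uncountable_open_interval[of "fst q" "fst q + \<epsilon>"] \<open>\<epsilon> > 0\<close>
    by auto
  then obtain T where T: "fst q < T" "T < fst q + \<epsilon>" "T \<notin> B"
    by (metis greaterThanLessThan_iff subsetI)
  define p where "p = (T, snd q)"
  have "p \<in> ball q \<epsilon>"
    using T by (cases q) (auto simp: p_def dist_Pair_Pair dist_real_def)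
  moreover define k where "k = half_turns p"
  have "2 * of_int k - 1 \<le> T" "T < 2 * of_int k + 1"
    using floor_correct[of "(T + 1) / 2"] by (auto simp: k_def half_turns_def p_def field_simps)
  moreover have "T \<noteq> 2 * of_int k - 1" "T \<noteq> P - 1 + 2 * of_int k" "T \<noteq> 1 - P + 2 * of_int k"
    using T(3) by (auto simp: B_def)
  ultimately have "p \<in> W" "regular P p"
    using \<epsilon> by (auto simp: regular_def open_times_def simp flip: k_def) (auto simp: p_def)
  then show ?thesis
    by blast
qed

lemma mk_label_in_labels: "mk_label a b \<in> labels"
  by (auto simp: mk_label_def labels_def)

text \<open>Regular points are dense, so the open image of \<open>V\<close> lies in the closure of
  the points labelled \<open>\<xi>\<close>. Any other piece containing \<open>proj P p\<close> would
  have labelled points in that image, where the letters already determine the label. The letters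
  themselves may vary over \<open>V\<close>, since different pairs represent
  \<open>Empty\<close>.\<close>

lemma label_of_proj:
  assumes P: "0 < P" "P < 1" and V: "open V" "p \<in> V"
    and lab: "\<And>q. q \<in> V \<Longrightarrow> \<exists>a b. \<xi> = mk_label a b \<and> has_letters P q a b"
  shows "proj P p \<notin> walls P" "label_of P (proj P p) = \<xi>"
proof -
  have "\<xi> \<in> labels"
    using lab[OF V(2)] mk_label_in_labels by auto
  have "proj P ` V \<subseteq> piece P \<xi>"
  proof
    fix x
    assume "x \<in> proj P ` V"
    then obtain q where q: "q \<in> V" "x = proj P q"
      by blast
    have "\<exists>y. y \<in> labelled P \<xi> \<and> y \<in> O'" if "x \<in> O'" "openin (XP_top P) O'" for O'
    proof -
      have "open (proj P -` O' \<inter> V)"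
        using that V(1) by (intro open_Int) (simp_all add: openin_XP_top)
      moreover have "q \<in> proj P -` O' \<inter> V"
        using q that(1) by simp
      ultimately obtain q' where "q' \<in> proj P -` O' \<inter> V" "regular P q'"
        using regular_dense[OF P] by meson
      then show ?thesis
        using lab[of q'] labelled_iff[OF P, of q' \<xi>] by blast
    qed
    moreover have "x \<in> XP P"
      using range_proj[of P] q by blast
    ultimately show "x \<in> piece P \<xi>"
      unfolding piece_def in_closure_of topspace_XP_top by blast
  qed
  then have "proj P ` V \<subseteq> piece_interior P \<xi>"
    by (rule interior_of_maximal[OF _ openin_proj_image[OF V(1)]])
  then have int: "proj P p \<in> piece_interior P \<xi>"
    using V(2) by (rule subsetD[OF _ imageI])
  show "proj P p \<notin> walls P"
    using int \<open>\<xi> \<in> labels\<close> unfolding walls_def by blast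
  show "label_of P (proj P p) = \<xi>"
    unfolding label_of_def
  proof (rule the_equality)
    fix \<eta>
    assume "\<eta> \<in> labels \<and> proj P p \<in> piece_interior P \<eta>"
    then have "proj P p \<in> XP_top P closure_of labelled P \<eta>"
      using interior_of_subset[of "XP_top P" "piece P \<eta>"] by (auto simp: piece_def)
    moreover have "proj P p \<in> proj P ` V"
      using V(2) by (rule imageI)
    ultimately obtain y where "y \<in> labelled P \<eta>" "y \<in> proj P ` V"
      using openin_proj_image[OF V(1), of P] unfolding in_closure_of by meson
    then obtain q where "q \<in> V" "proj P q \<in> labelled P \<eta>"
      by blast
    then obtain a b a' b' where "\<eta> = mk_label a b" "has_letters P q a b"
      "\<xi> = mk_label a' b'" "has_letters P q a' b'"
      using lab[of q] labelled_iff[OF P, of q \<eta>] by blast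
    then show "\<eta> = \<xi>"
      using has_letters_unique by metis
  qed (use int \<open>\<xi> \<in> labels\<close> in simp)
qed

context irrational_parameter
begin

section \<open>The tiling realized by an orbit of the exchange\<close>

definition pos :: "int \<times> int \<Rightarrow> real \<times> real \<times> real" where
  "pos = (\<lambda>(x, y). (1 + 2 * P * of_int x + 2 * of_int y, P / 2 + 2 * P * of_int x,
     P / 2 + 1 + 2 * P * of_int x + 2 * P * of_int y))"

lemma pos_coords:
  "fst (pos (x, y)) - 2 * of_int (turn x y) = time x"
  "fst (snd (pos (x, y))) - P * of_int (turn x y) = ucol x y"
  "snd (snd (pos (x, y))) - P * of_int (turn x y) = urow x y"
  by (auto simp: pos_def time_def turn_def ucol_def urow_def)

lemma has_lettersI:
  assumes k: "- 1 \<le> fst q - 2 * of_int k" "fst q - 2 * of_int k < 1"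
    and c: "region P c (fst q - 2 * of_int k) (fst (snd q) - P * of_int k)"
    and r: "region P r (fst q - 2 * of_int k) (snd (snd q) - P * of_int k)"
  shows "has_letters P q (if even k then c else flip_NS r) (if even k then flip_NS r else c)"
proof -
  obtain T U1 U2 where q: "q = (T, U1, U2)"
    by (cases q)
  have "half_turns q = k"
    using k by (auto simp: half_turns_def floor_eq_iff)
  then show ?thesis
    using k c r col_eq_Some_iff[OF P_pos P_less_1]
    by (auto simp: q has_letters_def Let_def row_def less_imp_le)
qed

lemma label_pos:
  "proj P (pos a) \<notin> walls P" "label_of P (proj P (pos a)) = mk_label (inn a) (out a)"
proof -
  obtain x y where a: "a = (x, y)"
    by force
  define k where "k = turn x y"
  define c where "c = cletter x y"
  define r where "r = rletter x y"
  define t where "t = (\<lambda>q :: real \<times> real \<times> real. fst q - 2 * of_int k)"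
  define u1 where "u1 = (\<lambda>q :: real \<times> real \<times> real. fst (snd q) - P * of_int k)"
  define u2 where "u2 = (\<lambda>q :: real \<times> real \<times> real. snd (snd q) - P * of_int k)"
  have cont: "continuous_on UNIV t" "continuous_on UNIV u1" "continuous_on UNIV u2"
    unfolding t_def u1_def u2_def by (intro continuous_intros)+
  have pos: "t (pos a) = time x" "u1 (pos a) = ucol x y" "u2 (pos a) = urow x y"
    unfolding t_def u1_def u2_def k_def a by (rule pos_coords)+
  have reg: "region P c (t (pos a)) (u1 (pos a))" "region P r (t (pos a)) (u2 (pos a))"
    using cletter_eq_iff[of x y c] rletter_eq_iff[of x y r] by (simp_all add: pos c_def r_def)
  have letters: "inn a = (if even k then c else flip_NS r)" "out a = (if even k then flip_NS r else c)"
    by (simp_all add: a inn_def out_def c_def r_def k_def)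
  define V1 where "V1 = {q. t q < 1 \<and> region P c (t q) (u1 q) \<and> region P r (t q) (u2 q)}"
  have "open V1"
    unfolding V1_def
    by (intro open_Collect_conj open_region[OF cont(1,2)] open_region[OF cont(1,3)]
        open_Collect_less[OF cont(1) continuous_on_const])
  moreover have "pos a \<in> V1"
    using reg time_bounds[of x] by (simp add: V1_def pos)
  ultimately have V1: "open V1" "pos a \<in> V1" .
  have lab1: "\<exists>a' b'. mk_label (inn a) (out a) = mk_label a' b' \<and> has_letters P q a' b'"
    if "q \<in> V1" "- 1 \<le> t q" for q
  proof -
    have "has_letters P q (inn a) (out a)"
      unfolding letters using that by (intro has_lettersI) (auto simp: V1_def t_def u1_def u2_def)
    then show ?thesis
      by blast
  qed
  have "\<exists>V. open V \<and> pos a \<in> V \<and>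
     (\<forall>q\<in>V. \<exists>a' b'. mk_label (inn a) (out a) = mk_label a' b' \<and> has_letters P q a' b')"
  \<comment> \<open>At time \<open>-1\<close> every neighbourhood meets the preceding half-period,
    so the label must be checked on both sides of the seam.\<close>
  proof (cases "- 1 < time x")
    case True
    have "open (V1 \<inter> {q. - 1 < t q})"
      by (intro open_Int V1 open_Collect_less[OF continuous_on_const cont(1)])
    then show ?thesis
      using V1 lab1 True by (intro exI[of _ "V1 \<inter> {q. - 1 < t q}"]) (auto simp: pos)
  next
    case False
    then have time: "time x = - 1"
      using time_bounds[of x] by simp
    have EW: "l = East \<or> l = West" if "region P l (- 1) u" for l u
      using that P_pos P_less_1 by (cases l) (auto simp: region_def)
    have cr: "c = East \<or> c = West" "r = East \<or> r = West"
      using reg EW by (auto simp: pos time)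
    \<comment> \<open>Below the seam there is one half-turn less: time grows by \<open>2\<close>,
      arguments grow by \<open>P\<close>, and by \<open>region_boundary\<close> the letters become
      opposite. The bound \<open>-3\<close> keeps the new time above \<open>-1\<close>.\<close>
    define V2 where "V2 = {q. - 3 < t q \<and> region P (opp c) (t q + 2) (u1 q + P)
      \<and> region P (opp r) (t q + 2) (u2 q + P)}"
    have "open V2"
      unfolding V2_def
      by (intro open_Collect_conj open_region open_Collect_less continuous_on_add
          continuous_on_const cont)
    moreover have "pos a \<in> V2"
      using reg region_boundary[OF cr(1) P_pos P_less_1] region_boundary[OF cr(2) P_pos P_less_1]
      by (simp add: V2_def pos time)
    moreover have "\<exists>a' b'. mk_label (inn a) (out a) = mk_label a' b' \<and> has_letters P q a' b'"
      if "q \<in> V2" "t q < - 1" for q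
    proof -
      have "has_letters P q (if even (k - 1) then opp c else flip_NS (opp r))
          (if even (k - 1) then flip_NS (opp r) else opp c)"
        using that by (intro has_lettersI) (auto simp: V2_def t_def u1_def u2_def algebra_simps)
      \<comment> \<open>Both letters are East or West. If they differ, taking opposites and
        exchanging roles cancel; if they agree, both sides give \<open>Empty\<close>.\<close>
      moreover have "mk_label (inn a) (out a) = mk_label (if even (k - 1) then opp c else flip_NS (opp r))
          (if even (k - 1) then flip_NS (opp r) else opp c)"
        unfolding letters using cr by (auto simp: mk_label_def)
      ultimately show ?thesis
        by blast
    qed
    ultimately show ?thesis
      using V1 lab1 by (intro exI[of _ "V1 \<inter> V2"]) (metis IntE IntI not_le open_Int)
  qed
  then obtain V where "open V" "pos a \<in> V"
    "\<And>q. q \<in> V \<Longrightarrow> \<exists>a' b'. mk_label (inn a) (out a) = mk_label a' b' \<and> has_letters P q a' b'"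
    by blast
  from label_of_proj[OF P_pos P_less_1 this]
  show "proj P (pos a) \<notin> walls P" "label_of P (proj P (pos a)) = mk_label (inn a) (out a)"
    by blast+
qed

lemma F_pos:
  assumes "active a"
  shows "F P (proj P (pos a)) = Some (proj P (pos (step a)))"
proof -
  have "inn a \<noteq> out a"
    using assms by (simp add: active_def)
  then have "label_of P (proj P (pos a)) = Pass (inn a) (out a)"
    by (simp add: label_pos mk_label_def)
  moreover have "shift P (Pass l (out a)) + pos a = pos (step a)" for l
    by (cases a; cases "out a") (auto simp: step_def pos_def algebra_simps)
  ultimately show ?thesis
    using label_pos(1)[of a] range_proj[of P] by (auto simp: F_def translate_proj)
qed

text \<open>Irrationality separates the tiles: the first coordinate of a lattice vector forces equal
  \<open>x\<close>, the second then forces the multiple \<open>i\<close> of the first generator to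
  vanish, and with it the difference in \<open>y\<close>.\<close>

lemma inj_proj_pos: "inj (\<lambda>a. proj P (pos a))"
proof (rule injI)
  fix a b
  assume "proj P (pos a) = proj P (pos b)"
  then obtain i j l :: int where
    *: "pos b - pos a = (4 * of_int i, 2 * P * of_int i + 2 * of_int j, 2 * P * of_int i + 2 * of_int l)"
    by (auto simp: proj_eq_iff lattice_iff)
  then have "P * of_int (fst b - fst a) = of_int (2 * i - (snd b - snd a))"
    by (cases a; cases b) (auto simp: pos_def algebra_simps)
  then have f: "fst b - fst a = 0"
    by (rule irrational_multiple[OF P_irrational])
  then have "P * of_int i = of_int (- j)" "real_of_int (snd b) - of_int (snd a) = of_int (2 * i)"
    using * by (cases a; cases b; auto simp: pos_def algebra_simps)+
  then have "i = 0" "snd b - snd a = 2 * i"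
    using irrational_multiple[OF P_irrational] by (blast, linarith)
  then show "a = b"
    using f by (auto simp: prod_eq_iff)
qed

end

theorem theorem1p1:
  fixes P :: real
  assumes "0 < P" and "P < 1" and "P \<notin> \<rat>"
  shows "\<exists>x\<in>XP P. \<exists>z. full_orbit P x z \<and> infinite (range z) \<and>
           (\<exists>c. plaid_path P z c \<and> \<not> bounded (fst ` range c) \<and> \<not> bounded (snd ` range c))"
proof -
  interpret irrational_parameter P
    by unfold_locales (rule assms)+
  define z where "z = (\<lambda>n. proj P (pos (path n)))"
  define c where "c = (\<lambda>n. (real_of_int (fst (path n)), real_of_int (snd (path n))))"
  have "full_orbit P (z 0) z"
    by (simp only: full_orbit_def z_def F_pos active_path path_Suc simp_thms)
  moreover have "infinite (range z)"
    using inj_compose[OF inj_proj_pos inj_path] by (auto simp: z_def comp_def dest: finite_imageD)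
  moreover have "plaid_path P z c"
  proof -
    have "c (n + 1) - c n = step_vector (label_of P (z n))" for n
    proof -
      have "inn (path n) \<noteq> out (path n)"
        using active_path[of n] unfolding active_def .
      then have "label_of P (z n) = Pass (inn (path n)) (out (path n))"
        by (simp add: z_def label_pos mk_label_def)
      moreover have "path (n + 1) = path n + dir (out (path n))"
        by (simp only: path_Suc step_def)
      ultimately show ?thesis
        by (cases "out (path n)") (auto simp: c_def)
    qed
    then show ?thesis
      by (simp add: plaid_path_def)
  qed
  moreover have "\<not> bounded (fst ` range c)" "\<not> bounded (snd ` range c)"
  proof -
    have *: "B < \<bar>real_of_int m\<bar>" if "\<lceil>B\<rceil> < \<bar>m\<bar>" for B m
      using that by linarith
    have "\<exists>n. B < \<bar>fst (c n)\<bar>" "\<exists>n. B < \<bar>snd (c n)\<bar>" for B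
      using unbounded_path[of "\<lceil>B\<rceil>"] * by (auto simp: c_def)
    then show "\<not> bounded (fst ` range c)" "\<not> bounded (snd ` range c)"
      by (auto simp: bounded_iff not_le)
  qed
  moreover have "z 0 \<in> XP P"
    using range_proj[of P] by (auto simp: z_def)
  ultimately show ?thesis
    by blast
qed

end
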